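(* Under the standing assumptions in the context, for every $\mathcal F\in\mathcal W'$ the equation $\mathcal A(\mathbf u,p)=\mathcal F$ has a unique solution $(\mathbf u,p)\in\mathcal W$.
   Context: $n\ge2$, $\Omega\subset\mathbb R^n$ open bounded with $C^1$ boundary. $F:\mathbb R^n\to\mathbb R^n$ satisfies $F(0)=0$ and, for constants $s>2$, $c_1,c_2>0$ and all $x,y$: $|F(x)-F(y)|\le c_1(1+|x|^{s-2}+|y|^{s-2})|x-y|$ and $(F(x)-F(y))\cdot(x-y)\ge c_2|x-y|^s$. Let $r=s/(s-1)$. $V=\mathbf W_s(\mathrm{div},\Omega)=\{\mathbf v\in(L^s(\Omega))^n:\operatorname{div}\mathbf v\in L^s(\Omega)\}$ with norm $(\|\mathbf v\|_{L^s}^s+\|\operatorname{div}\mathbf v\|_{L^s}^s)^{1/s}$, $Z=L^r(\Omega)$, and $\mathcal W=V\times Z$ with norm $\|(\mathbf u,p)\|_{\mathcal W}=\|\mathbf u\|_V+\|p\|_Z$; $\mathcal W'$ is its dual. Set $a(\mathbf u,\mathbf v)=\int_\Omega F(\mathbf u)\cdot\mathbf v\,dx$, $b(\mathbf v,q)=\int_\Omega(\operatorname{div}\mathbf v)q\,dx$, and $\mathcal A:\mathcal W\to\mathcal W'$ by $\langle\mathcal A(\mathbf u,p),(\mathbf v,q)\rangle=a(\mathbf u,\mathbf v)-b(\mathbf v,p)+b(\mathbf u,q)$. *)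

theory Defs
  imports "HOL-Analysis.Analysis"
begin

coinductive smooth_fun :: "(real^'n \<Rightarrow> real) \<Rightarrow> bool" where
  "(\<forall>x. f differentiable (at x)) \<Longrightarrow>
   (\<forall>i. smooth_fun (\<lambda>x. frechet_derivative f (at x) (axis i 1))) \<Longrightarrow> smooth_fun f"

definition grad :: "(real^'n \<Rightarrow> real) \<Rightarrow> real^'n \<Rightarrow> real^'n" where
  "grad f x = (\<chi> i. frechet_derivative f (at x) (axis i 1))"

definition test_fun :: "(real^'n) set \<Rightarrow> (real^'n \<Rightarrow> real) \<Rightarrow> bool" where
  "test_fun \<Omega> \<phi> \<longleftrightarrow> smooth_fun \<phi> \<and>
     (\<exists>K. compact K \<and> K \<subseteq> \<Omega> \<and> (\<forall>x. x \<notin> K \<longrightarrow> \<phi> x = 0))"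

definition in_Lp :: "real \<Rightarrow> (real^'n) set \<Rightarrow> (real^'n \<Rightarrow> 'b::euclidean_space) \<Rightarrow> bool" where
  "in_Lp p \<Omega> f \<longleftrightarrow> f \<in> borel_measurable (lebesgue_on \<Omega>) \<and>
     integrable (lebesgue_on \<Omega>) (\<lambda>x. norm (f x) powr p)"

definition Lp_norm :: "real \<Rightarrow> (real^'n) set \<Rightarrow> (real^'n \<Rightarrow> 'b::euclidean_space) \<Rightarrow> real" where
  "Lp_norm p \<Omega> f = (LINT x|lebesgue_on \<Omega>. norm (f x) powr p) powr (1/p)"

definition weak_div :: "(real^'n) set \<Rightarrow> (real^'n \<Rightarrow> real^'n) \<Rightarrow> (real^'n \<Rightarrow> real) \<Rightarrow> bool" where
  "weak_div \<Omega> v w \<longleftrightarrow> (\<forall>\<phi>. test_fun \<Omega> \<phi> \<longrightarrow>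
     (LINT x|lebesgue_on \<Omega>. v x \<bullet> grad \<phi> x) = - (LINT x|lebesgue_on \<Omega>. w x * \<phi> x))"

definition in_Wdiv :: "real \<Rightarrow> (real^'n) set \<Rightarrow> (real^'n \<Rightarrow> real^'n) \<Rightarrow> (real^'n \<Rightarrow> real) \<Rightarrow> bool" where
  "in_Wdiv s \<Omega> v w \<longleftrightarrow> in_Lp s \<Omega> v \<and> in_Lp s \<Omega> w \<and> weak_div \<Omega> v w"

definition Wdiv_norm :: "real \<Rightarrow> (real^'n) set \<Rightarrow> (real^'n \<Rightarrow> real^'n) \<Rightarrow> (real^'n \<Rightarrow> real) \<Rightarrow> real" where
  "Wdiv_norm s \<Omega> v w =
     ((LINT x|lebesgue_on \<Omega>. norm (v x) powr s) + (LINT x|lebesgue_on \<Omega>. \<bar>w x\<bar> powr s)) powr (1/s)"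

definition C1_boundary :: "(real^'n) set \<Rightarrow> bool" where
  "C1_boundary \<Omega> \<longleftrightarrow> (\<forall>x\<in>frontier \<Omega>. \<exists>r>0. \<exists>\<psi> g.
     (\<forall>y\<in>ball x r. (\<psi> has_derivative (\<lambda>h. g y \<bullet> h)) (at y)) \<and>
     continuous_on (ball x r) g \<and> (\<forall>y\<in>ball x r. g y \<noteq> 0) \<and>
     \<Omega> \<inter> ball x r = {y\<in>ball x r. \<psi> y < 0})"

definition in_dual :: "real \<Rightarrow> (real^'n) set \<Rightarrow>
    ((real^'n \<Rightarrow> real^'n) \<Rightarrow> (real^'n \<Rightarrow> real) \<Rightarrow> real) \<Rightarrow> bool" where
  "in_dual s \<Omega> G \<longleftrightarrow> (let r = s / (s - 1) in
     (\<forall>v1 w1 q1 v2 w2 q2 a b. in_Wdiv s \<Omega> v1 w1 \<and> in_Lp r \<Omega> q1 \<and> in_Wdiv s \<Omega> v2 w2 \<and> in_Lp r \<Omega> q2 \<longrightarrow>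
        G (\<lambda>x. a *\<^sub>R v1 x + b *\<^sub>R v2 x) (\<lambda>x. a * q1 x + b * q2 x) = a * G v1 q1 + b * G v2 q2) \<and>
     (\<exists>C. \<forall>v w q. in_Wdiv s \<Omega> v w \<and> in_Lp r \<Omega> q \<longrightarrow>
        \<bar>G v q\<bar> \<le> C * (Wdiv_norm s \<Omega> v w + Lp_norm r \<Omega> q)))"

definition solves :: "real \<Rightarrow> (real^'n) set \<Rightarrow> (real^'n \<Rightarrow> real^'n) \<Rightarrow>
    ((real^'n \<Rightarrow> real^'n) \<Rightarrow> (real^'n \<Rightarrow> real) \<Rightarrow> real) \<Rightarrow>
    (real^'n \<Rightarrow> real^'n) \<Rightarrow> (real^'n \<Rightarrow> real) \<Rightarrow> (real^'n \<Rightarrow> real) \<Rightarrow> bool" where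
  "solves s \<Omega> F G u du p \<longleftrightarrow> (let r = s / (s - 1) in
     in_Wdiv s \<Omega> u du \<and> in_Lp r \<Omega> p \<and>
     (\<forall>v dv q. in_Wdiv s \<Omega> v dv \<and> in_Lp r \<Omega> q \<longrightarrow>
        (LINT x|lebesgue_on \<Omega>. F (u x) \<bullet> v x) - (LINT x|lebesgue_on \<Omega>. dv x * p x)
          + (LINT x|lebesgue_on \<Omega>. du x * q x) = G v q))"

end

theory Submission
  imports Defs "HOL-Library.Function_Algebras"
begin

text \<open>
  Write \<open>M\<close> for Lebesgue measure on \<open>\<Omega>\<close> and \<open>r = s/(s-1)\<close>. Testing with \<open>(0, q)\<close>, the equation says that
  \<open>div u\<close> is the element \<open>g\<close> of \<open>L\<^sup>s\<close> representing \<open>G(0, \<cdot>)\<close>. The divergence has a bounded right inverse on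
  any bounded open set: integrate the datum, extended by zero, along a coordinate direction. Hence
  \<open>u = u\<^sub>0 + z\<close> with \<open>div u\<^sub>0 = g\<close> and \<open>z\<close> divergence free, and \<open>z\<close> solves a monotone, coercive equation on
  the closed subspace of divergence-free fields. The remaining functional \<open>a(u, v) - G(v, 0)\<close> depends on
  \<open>v\<close> only through \<open>div v\<close>, so it is represented by some \<open>p\<close> in \<open>L\<^sup>r\<close>.

  The monotone equation is solved without weak topologies. For finitely many test points, Minty's
  inequalities have a common solution because a matrix game with \<open>A\<^sub>i\<^sub>j + A\<^sub>j\<^sub>i \<ge> 0\<close> has nonnegative value;
  uniform convexity (Clarkson's inequality, exponent at least 2) supplies the finite intersection
  property for bounded closed convex sets. The same theorem applied to \<open>y |y|\<^sup>s\<^sup>-\<^sup>2\<close> yields the Riesz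
  representation of functionals on \<open>L\<^sup>s\<close>, and a truncation argument that on \<open>L\<^sup>r\<close>.
\<close>

subsection \<open>Monotone matrix games\<close>

text \<open>Monotonicity of \<open>F\<close> controls \<open>u\<close> in L^s but says nothing about
  \<open>div u\<close>, so the operator is not coercive for the norm of V. Prescribing the
  divergence removes this defect: differences of admissible fields are divergence free, and for them
  the V-norm is just the L^s norm. The exponents shape the rest. Since s > 2, the conjugate exponent
  satisfies 1 < r < 2, where the Clarkson inequality used here fails. All compactness is therefore
  drawn from L^s, and the pressure is obtained as the representative of a functional on L^s.
  Functions agreeing almost everywhere are not identified. The integral of |f|^p takes the place of
  the norm; it may vanish on nonzero functions, so limits are determined only up to null sets. The
  right inverse of the divergence acts three times: it lifts the datum to \<open>u0\<close>, it
  transports the residual functional to L^s, and through surjectivity it makes the pressure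
  unique.\<close>

text \<open>Von Neumann's descent: moving a minimiser \<open>l\<close> of the squared violation \<open>\<psi>\<close> towards the violation
  vector \<open>\<phi>\<close> itself would decrease \<open>\<psi>\<close> to first order.\<close>

lemma monotone_game:
  fixes A :: "'i \<Rightarrow> 'i \<Rightarrow> real"
  assumes fin: "finite I" "I \<noteq> {}"
    and A: "\<And>i j. i \<in> I \<Longrightarrow> j \<in> I \<Longrightarrow> 0 \<le> A i j + A j i"
  shows "\<exists>l. (\<forall>i\<in>I. 0 \<le> l i) \<and> sum l I = 1 \<and> (\<forall>i\<in>I. 0 \<le> (\<Sum>j\<in>I. A i j * l j))"
proof -
  \<comment> \<open>Coordinates outside \<open>I\<close> are pinned to 0, so the simplex lies in a
    product of compact sets over the whole index type and inherits compactness from the product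
    topology.\<close>
  define P :: "('i \<Rightarrow> real) set" where "P = PiE UNIV (\<lambda>i. if i \<in> I then {0..1} else {0})"
  define S where "S = P \<inter> {l. sum l I = 1}"
  have cP: "compact P"
  proof -
    have "compactin (product_topology (\<lambda>i. euclidean) UNIV) P"
      unfolding P_def by (subst compactin_PiE) auto
    then show ?thesis
      unfolding euclidean_product_topology by simp
  qed
  have cl: "closed {l::'i \<Rightarrow> real. sum l I = 1}"
    by (intro closed_Collect_eq continuous_on_sum continuous_on_product_coordinates continuous_on_const)
  have cS: "compact S"
    unfolding S_def by (intro compact_Int_closed cP cl)
  have memS: "l \<in> S" if "\<And>i. i \<in> I \<Longrightarrow> 0 \<le> l i" "\<And>i. i \<notin> I \<Longrightarrow> l i = 0" "sum l I = 1" for l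
  proof -
    have "l i \<le> 1" if "i \<in> I" for i
      using member_le_sum[of i I l] that \<open>sum l I = 1\<close> \<open>\<And>i. i \<in> I \<Longrightarrow> 0 \<le> l i\<close> fin by auto
    then show ?thesis
      using that unfolding S_def P_def by auto
  qed
  have Sdest: "0 \<le> l i" "i \<notin> I \<Longrightarrow> l i = 0" "sum l I = 1" if "l \<in> S" for l i
    using that unfolding S_def P_def PiE_def Pi_def by (auto split: if_splits)
  obtain i0 where "i0 \<in> I" using fin by auto
  have "(\<lambda>i. if i = i0 then 1 else 0) \<in> S"
    using \<open>i0 \<in> I\<close> fin by (intro memS) auto
  then have neS: "S \<noteq> {}" by auto
  define Al where "Al l i = (\<Sum>j\<in>I. A i j * l j)" for l i
  define \<psi> where "\<psi> l = (\<Sum>i\<in>I. (max 0 (- Al l i))\<^sup>2)" for l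
  have "continuous_on UNIV \<psi>"
    unfolding \<psi>_def Al_def
    by (intro continuous_on_sum continuous_intros continuous_on_max continuous_on_product_coordinates)
  then have "continuous_on S \<psi>" by (rule continuous_on_subset) auto
  from continuous_attains_inf[OF cS neS this]
  obtain l where l: "l \<in> S" and min: "\<And>k. k \<in> S \<Longrightarrow> \<psi> l \<le> \<psi> k" by auto
  have "\<psi> l = 0"
  proof (rule ccontr)
    assume "\<psi> l \<noteq> 0"
    moreover have "\<psi> l \<ge> 0" unfolding \<psi>_def by (intro sum_nonneg) auto
    ultimately have pos: "\<psi> l > 0" by auto
    define \<phi> where "\<phi> i = (if i \<in> I then max 0 (- Al l i) else 0)" for i
    define \<Phi> where "\<Phi> = sum \<phi> I"
    have \<phi>0: "\<phi> i \<ge> 0" for i by (auto simp: \<phi>_def)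
    have \<psi>\<phi>: "\<psi> l = (\<Sum>i\<in>I. (\<phi> i)\<^sup>2)" unfolding \<psi>_def \<phi>_def by (intro sum.cong) auto
    have "\<Phi> \<noteq> 0"
    proof
      assume "\<Phi> = 0"
      then have "\<forall>i\<in>I. \<phi> i = 0" unfolding \<Phi>_def using fin \<phi>0 by (subst (asm) sum_nonneg_eq_0_iff) auto
      then show False using pos \<psi>\<phi> by simp
    qed
    moreover have "\<Phi> \<ge> 0" unfolding \<Phi>_def by (intro sum_nonneg \<phi>0)
    ultimately have \<Phi>: "\<Phi> > 0" by auto
    define \<delta> where "\<delta> j = \<phi> j - \<Phi> * l j" for j
    define D where "D = (\<Sum>i\<in>I. (Al \<delta> i)\<^sup>2)"
    have D0: "D \<ge> 0" unfolding D_def by (intro sum_nonneg) auto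
    \<comment> \<open>The quadratic form sees only the symmetric part of \<open>A\<close>, whose
      entries are nonnegative, and it is evaluated at the nonnegative vector
      \<open>\<phi>\<close>.\<close>
    have q: "0 \<le> (\<Sum>i\<in>I. \<phi> i * Al \<phi> i)"
    proof -
      have e1: "(\<Sum>i\<in>I. \<phi> i * Al \<phi> i) = (\<Sum>i\<in>I. \<Sum>j\<in>I. A i j * \<phi> i * \<phi> j)"
        unfolding Al_def by (simp add: sum_distrib_left mult_ac)
      have e2: "(\<Sum>i\<in>I. \<Sum>j\<in>I. A i j * \<phi> i * \<phi> j) = (\<Sum>i\<in>I. \<Sum>j\<in>I. A j i * \<phi> i * \<phi> j)"
        by (subst sum.swap) (simp add: mult_ac)
      have "0 \<le> (\<Sum>i\<in>I. \<Sum>j\<in>I. (A i j + A j i) * \<phi> i * \<phi> j)"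
        by (intro sum_nonneg mult_nonneg_nonneg A \<phi>0)
      also have "\<dots> = 2 * (\<Sum>i\<in>I. \<phi> i * Al \<phi> i)"
        using e1 e2 by (simp add: distrib_right sum.distrib)
      finally show ?thesis by simp
    qed
    have lin: "Al (\<lambda>j. a * f j + b * g j) i = a * Al f i + b * Al g i" for a b f g i
      unfolding Al_def by (simp add: sum_distrib_left sum.distrib algebra_simps)
    have Al\<delta>: "Al \<delta> i = Al \<phi> i - \<Phi> * Al l i" for i
      using lin[of 1 \<phi> "- \<Phi>" l i] unfolding \<delta>_def by simp
    have "\<phi> i * Al l i = - (\<phi> i)\<^sup>2" if "i \<in> I" for i
      using that by (auto simp: \<phi>_def max_def power2_eq_square)
    then have "(\<Sum>i\<in>I. \<phi> i * Al l i) = - \<psi> l"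
      unfolding \<psi>\<phi> by (simp add: sum_negf)
    then have desc: "(\<Sum>i\<in>I. \<phi> i * Al \<delta> i) \<ge> \<Phi> * \<psi> l"
      using q unfolding Al\<delta> 
      by (simp add: right_diff_distrib sum_subtractf mult.left_commute[of _ \<Phi>] flip: sum_distrib_left)
    \<comment> \<open>The first bound keeps \<open>k\<close> in the simplex. The second lets the
      first-order gain \<open>2 * (\<Phi> * \<psi> l)\<close> beat the quadratic error
      \<open>t * D\<close>; the \<open>+ 1\<close> guards against \<open>D = 0\<close>.\<close>
    define t where "t = min (1 / \<Phi>) (\<Phi> * \<psi> l / (D + 1))"
    have t: "t > 0" "t * \<Phi> \<le> 1" "t * D < 2 * (\<Phi> * \<psi> l)"
    proof -
      show t0: "t > 0" unfolding t_def using \<Phi> pos D0 by auto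
      have "t * \<Phi> \<le> 1 / \<Phi> * \<Phi>" unfolding t_def using \<Phi> by (intro mult_right_mono) auto
      then show "t * \<Phi> \<le> 1" using \<Phi> by simp
      have "t * D \<le> t * (D + 1)" using t0 by simp
      also have "\<dots> \<le> \<Phi> * \<psi> l / (D + 1) * (D + 1)" unfolding t_def using D0 by (intro mult_right_mono) auto
      also have "\<dots> = \<Phi> * \<psi> l" using D0 by simp
      also have "\<dots> < 2 * (\<Phi> * \<psi> l)" using \<Phi> pos by simp
      finally show "t * D < 2 * (\<Phi> * \<psi> l)" .
    qed
    define k where "k j = 1 * l j + t * \<delta> j" for j
    have k': "k j = (1 - t * \<Phi>) * l j + t * \<phi> j" for j
      unfolding k_def \<delta>_def by (simp add: algebra_simps)
    have "k \<in> S"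
    proof (rule memS)
      show "k i \<ge> 0" for i unfolding k' using t Sdest(1)[OF l, of i] \<phi>0[of i]
        by (intro add_nonneg_nonneg mult_nonneg_nonneg) auto
      show "k i = 0" if "i \<notin> I" for i using that Sdest(2)[OF l] unfolding k' \<phi>_def by simp
      show "sum k I = 1" unfolding k' using Sdest(3)[OF l]
        by (simp add: sum.distrib \<Phi>_def flip: sum_distrib_left)
    qed
    then have "\<psi> l \<le> \<psi> k" by (rule min)
    also have "\<psi> k \<le> (\<Sum>i\<in>I. (\<phi> i - t * Al \<delta> i)\<^sup>2)"
      unfolding \<psi>_def
    proof (rule sum_mono)
      fix i assume i: "i \<in> I"
      have Ak: "Al k i = Al l i + t * Al \<delta> i" using lin[of 1 l t \<delta> i] unfolding k_def by simp
      \<comment> \<open>This bound on the squared positive part replaces differentiating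
        \<open>\<psi>\<close>: it gives an exact quadratic majorant that touches
        \<open>\<psi>\<close> at \<open>l\<close>.\<close>
      have *: "(max 0 (a + h))\<^sup>2 \<le> (max 0 a + h)\<^sup>2" for a h :: real
        by (cases "a + h \<le> 0"; cases "a \<ge> 0") (auto simp: max_def intro: power_mono)
      show "(max 0 (- Al k i))\<^sup>2 \<le> (\<phi> i - t * Al \<delta> i)\<^sup>2"
        using *[of "- Al l i" "- t * Al \<delta> i"] i unfolding Ak \<phi>_def by simp
    qed
    also have "\<dots> = \<psi> l - 2 * t * (\<Sum>i\<in>I. \<phi> i * Al \<delta> i) + t\<^sup>2 * D"
      unfolding \<psi>\<phi> D_def
      by (simp add: power2_diff sum.distrib sum_subtractf sum_distrib_left power_mult_distrib mult_ac)
    also have "\<dots> \<le> \<psi> l - 2 * t * (\<Phi> * \<psi> l) + t\<^sup>2 * D"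
      using desc t by auto
    finally have "t * (2 * (\<Phi> * \<psi> l)) \<le> t * (t * D)" by (simp add: power2_eq_square)
    then show False using t by (simp add: mult_le_cancel_left_pos)
  qed
  then have "\<forall>i\<in>I. (max 0 (- Al l i))\<^sup>2 = 0"
    unfolding \<psi>_def using fin by (subst (asm) sum_nonneg_eq_0_iff) auto
  then have "\<forall>i\<in>I. 0 \<le> Al l i" by (auto simp: max_def split: if_splits)
  then show ?thesis using Sdest[OF l] unfolding Al_def by blast
qed

text \<open>Pointwise operations turn the function type itself into a vector space, so that
  \<open>subspace\<close> and \<open>convex\<close> apply to sets of fields without a quotient by
  null functions.\<close>

instantiation "fun" :: (type, real_vector) real_vector
begin

definition scaleR_fun :: "real \<Rightarrow> ('a \<Rightarrow> 'b) \<Rightarrow> 'a \<Rightarrow> 'b" where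
  "scaleR_fun c f = (\<lambda>x. c *\<^sub>R f x)"

instance
  by standard (auto simp: scaleR_fun_def fun_eq_iff scaleR_add_right scaleR_add_left)

end

lemma scaleR_fun_apply [simp]: "(c *\<^sub>R f) x = c *\<^sub>R f x"
  by (simp add: scaleR_fun_def)

subsection \<open>Monotone operators on uniformly convex spaces\<close>

text \<open>\<open>E\<close> models the p-th power of a norm. The triangle inequality survives only
  up to the factor \<open>\<kappa>\<close>, and \<open>E x = 0\<close> need not force
  \<open>x = 0\<close>. In \<open>uniform\<close>, the convexity gap at the midpoint controls the
  distance, which is how minimising sequences become Cauchy.\<close>

locale uniformly_convex_energy =
  fixes X :: "'a::real_vector set" and E :: "'a \<Rightarrow> real" and \<kappa> :: real
  assumes subspace: "subspace X"
    and nonneg: "x \<in> X \<Longrightarrow> 0 \<le> E x"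
    and zero: "E 0 = 0"
    and convex: "convex_on X E"
    and const_nonneg: "0 \<le> \<kappa>"
    and uniform: "x \<in> X \<Longrightarrow> y \<in> X \<Longrightarrow> E (x - y) \<le> \<kappa> * ((E x + E y) / 2 - E ((1/2) *\<^sub>R (x + y)))"
    and quasi_triangle: "x \<in> X \<Longrightarrow> y \<in> X \<Longrightarrow> E (x + y) \<le> \<kappa> * (E x + E y)"
    and complete: "(\<And>n. u n \<in> X) \<Longrightarrow> (\<And>e. e > 0 \<Longrightarrow> \<exists>N. \<forall>m\<ge>N. \<forall>n\<ge>N. E (u m - u n) < e)
       \<Longrightarrow> \<exists>x\<in>X. (\<lambda>n. E (u n - x)) \<longlonglongrightarrow> 0"
    and lower_semicontinuous: "(\<And>n. u n \<in> X) \<Longrightarrow> x \<in> X \<Longrightarrow> (\<lambda>n. E (u n - x)) \<longlonglongrightarrow> 0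
       \<Longrightarrow> (\<And>n. E (u n) \<le> R) \<Longrightarrow> E x \<le> R"
begin

lemma diff_mem: "x \<in> X \<Longrightarrow> y \<in> X \<Longrightarrow> x - y \<in> X"
  and add_mem: "x \<in> X \<Longrightarrow> y \<in> X \<Longrightarrow> x + y \<in> X"
  and scale_mem: "x \<in> X \<Longrightarrow> c *\<^sub>R x \<in> X"
  and zero_mem: "0 \<in> X"
  using subspace by (auto intro: subspace_diff subspace_add subspace_scale subspace_0)

text \<open>Substitute for weak compactness: near-minimisers of the energy over finite intersections form a
  Cauchy sequence once the infima are close to their supremum over all finite intersections.\<close>

lemma finite_intersection:
  assumes conv: "\<And>j. j \<in> J \<Longrightarrow> convex (C j)"
    and closed: "\<And>j u x. j \<in> J \<Longrightarrow> (\<And>n. u n \<in> C j) \<Longrightarrow> (\<And>n. u n \<in> X) \<Longrightarrow> x \<in> X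
        \<Longrightarrow> (\<lambda>n. E (u n - x)) \<longlonglongrightarrow> 0 \<Longrightarrow> x \<in> C j"
    and fip: "\<And>S. finite S \<Longrightarrow> S \<subseteq> J \<Longrightarrow> \<exists>x\<in>X. E x \<le> M \<and> (\<forall>j\<in>S. x \<in> C j)"
  shows "\<exists>x\<in>X. \<forall>j\<in>J. x \<in> C j"
proof -
  define D where "D S = {x \<in> X. \<forall>j\<in>S. x \<in> C j}" for S
  define d where "d S = Inf (E ` D S)" for S
  let ?F = "{S. finite S \<and> S \<subseteq> J}"
  have Dne: "D S \<noteq> {}" and dM: "d S \<le> M" if S: "S \<in> ?F" for S
  proof -
    obtain x where x: "x \<in> D S" "E x \<le> M" using fip[of S] S by (auto simp: D_def)
    then show "D S \<noteq> {}" by auto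
    have "d S \<le> E x" unfolding d_def using x by (intro cInf_lower bdd_belowI[of _ 0]) (auto simp: D_def nonneg)
    then show "d S \<le> M" using x by simp
  qed
  have dle: "d S \<le> E x" if "x \<in> D S" for S x
    unfolding d_def using that by (intro cInf_lower bdd_belowI[of _ 0]) (auto simp: D_def nonneg)
  have near: "\<exists>x\<in>D S. E x < d S + e" if "S \<in> ?F" "e > 0" for S e
  proof -
    have "Inf (E ` D S) < d S + e" using that unfolding d_def by simp
    then show ?thesis using cInf_lessD[of "E ` D S" "d S + e"] Dne[OF that(1)] by auto
  qed
  \<comment> \<open>The midpoint stays in \<open>D S\<close> by convexity, so its energy is at least
    \<open>d S\<close>; two points of energy at most \<open>B\<close> then leave a convexity gap of
    at most \<open>B - d S\<close>.\<close>
  have close: "E (x - y) \<le> \<kappa> * (B - d S)" if "S \<in> ?F" "x \<in> D S" "y \<in> D S" "E x \<le> B" "E y \<le> B" for S x y B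
  proof -
    have xy: "x \<in> X" "y \<in> X" using that by (auto simp: D_def)
    have "(1/2) *\<^sub>R (x + y) \<in> C j" if "j \<in> S" for j
      using convexD[OF conv[of j], of x y "1/2" "1/2"] \<open>S \<in> ?F\<close> \<open>x \<in> D S\<close> \<open>y \<in> D S\<close> that
      by (auto simp: D_def scaleR_add_right)
    then have "(1/2) *\<^sub>R (x + y) \<in> D S" using xy by (auto simp: D_def intro: scale_mem add_mem)
    then have "d S \<le> E ((1/2) *\<^sub>R (x + y))" by (rule dle)
    moreover have "(E x + E y) / 2 \<le> B" using that by simp
    ultimately have "(E x + E y) / 2 - E ((1/2) *\<^sub>R (x + y)) \<le> B - d S" by (rule diff_mono[rotated])
    then show ?thesis using uniform[OF xy] const_nonneg by (meson mult_left_mono order_trans)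
  qed
  define s where "s = Sup (d ` ?F)"
  have bdd: "bdd_above (d ` ?F)" using dM by (intro bdd_aboveI[of _ M]) auto
  have ds: "d S \<le> s" if "S \<in> ?F" for S
    unfolding s_def using that bdd by (intro cSup_upper) auto
  define \<epsilon> where "\<epsilon> n = inverse (real (Suc n))" for n
  have \<epsilon>: "\<epsilon> n > 0" "m \<le> n \<Longrightarrow> \<epsilon> n \<le> \<epsilon> m" for m n by (auto simp: \<epsilon>_def field_simps)
  have \<epsilon>0: "\<epsilon> \<longlonglongrightarrow> 0" unfolding \<epsilon>_def by (rule LIMSEQ_inverse_real_of_nat)
  have "\<exists>S\<in>?F. s - \<epsilon> n < d S" for n
    using less_cSupD[of "d ` ?F" "s - \<epsilon> n"] \<epsilon>(1)[of n] unfolding s_def by auto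
  then obtain S0 where S0: "\<And>n. S0 n \<in> ?F" "\<And>n. s - \<epsilon> n < d (S0 n)" by metis
  \<comment> \<open>Taking unions makes the sets \<open>D (S n)\<close> decreasing, while the infima
    can only move up towards \<open>s\<close>.\<close>
  define S where "S n = (\<Union>k\<le>n. S0 k)" for n
  have SF: "S n \<in> ?F" for n using S0(1) by (auto simp: S_def)
  have Smono: "D (S n) \<subseteq> D (S m)" if "m \<le> n" for m n
    using that unfolding D_def S_def by auto
  have dmono: "d A \<le> d B" if "A \<subseteq> B" "B \<in> ?F" for A B
    unfolding d_def using that Dne[OF that(2)]
    by (intro cInf_superset_mono bdd_belowI[of _ 0]) (auto simp: D_def nonneg)
  have dS: "s - \<epsilon> n < d (S n)" for n
    using less_le_trans[OF S0(2)[of n] dmono[OF _ SF]] by (auto simp: S_def)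
  have "\<exists>y\<in>D (S n). E y < d (S n) + \<epsilon> n" for n by (rule near[OF SF \<epsilon>(1)])
  then obtain x where x: "\<And>n. x n \<in> D (S n)" "\<And>n. E (x n) < d (S n) + \<epsilon> n" by metis
  have xX: "x n \<in> X" for n using x by (auto simp: D_def)
  have xs: "E (x n) \<le> s + \<epsilon> n" for n using x(2)[of n] ds[OF SF, of n] by simp
  have est: "E (y - z) \<le> \<kappa> * (2 * \<epsilon> n)" if "y \<in> D (S n)" "z \<in> D (S n)" "E y \<le> s + \<epsilon> n" "E z \<le> s + \<epsilon> n" for y z n
  proof -
    have "E (y - z) \<le> \<kappa> * ((s + \<epsilon> n) - d (S n))" by (rule close[OF SF that])
    also have "\<dots> \<le> \<kappa> * (2 * \<epsilon> n)" using dS[of n] const_nonneg by (intro mult_left_mono) auto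
    finally show ?thesis .
  qed
  have lim: "(\<lambda>n. \<kappa> * (2 * \<epsilon> n)) \<longlonglongrightarrow> 0"
    using tendsto_mult_right_zero[OF tendsto_mult_right_zero[OF \<epsilon>0, of 2], of \<kappa>] by simp
  have "\<exists>N. \<forall>m\<ge>N. \<forall>n\<ge>N. E (x m - x n) < e" if "e > 0" for e
  proof -
    obtain N where N: "\<kappa> * (2 * \<epsilon> N) < e"
      using order_tendstoD(2)[OF lim \<open>e > 0\<close>] by (auto simp: eventually_sequentially)
    have "E (x m - x n) < e" if "m \<ge> N" "n \<ge> N" for m n
    proof -
      have "E (x m - x n) \<le> \<kappa> * (2 * \<epsilon> N)"
        using x(1) Smono[OF that(1)] Smono[OF that(2)] xs[of m] xs[of n] \<epsilon>(2)[OF that(1)] \<epsilon>(2)[OF that(2)]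
        by (intro est) (auto intro: order_trans)
      then show ?thesis using N by simp
    qed
    then show ?thesis by blast
  qed
  from complete[of x, OF xX this] obtain z where z: "z \<in> X" "(\<lambda>n. E (x n - z)) \<longlonglongrightarrow> 0" by blast
  have "z \<in> C j" if "j \<in> J" for j
  proof -
    \<comment> \<open>The index \<open>j\<close> need not occur in any \<open>S n\<close>.
      Near-minimisers over \<open>insert j (S n)\<close> lie in \<open>C j\<close>, and also in
      \<open>D (S n)\<close> with energy at most \<open>s + \<epsilon> n\<close>; so they are close
      to \<open>x n\<close> and converge to the same \<open>z\<close>.\<close>
    have SjF: "insert j (S n) \<in> ?F" for n using SF that by auto
    have "\<exists>y\<in>D (insert j (S n)). E y < d (insert j (S n)) + \<epsilon> n" for n by (rule near[OF SjF \<epsilon>(1)])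
    then obtain y where y: "\<And>n. y n \<in> D (insert j (S n))" "\<And>n. E (y n) < d (insert j (S n)) + \<epsilon> n"
      by metis
    have yX: "y n \<in> X" and yC: "y n \<in> C j" and yS: "y n \<in> D (S n)" for n
      using y(1)[of n] by (auto simp: D_def)
    have ys: "E (y n) \<le> s + \<epsilon> n" for n using y(2)[of n] ds[OF SjF, of n] by simp
    have yz: "E (y n - z) \<le> \<kappa> * (\<kappa> * (2 * \<epsilon> n) + E (x n - z))" for n
    proof -
      have "E (y n - z) = E ((y n - x n) + (x n - z))" by simp
      also have "\<dots> \<le> \<kappa> * (E (y n - x n) + E (x n - z))"
        by (intro quasi_triangle diff_mem yX xX z)
      also have "\<dots> \<le> \<kappa> * (\<kappa> * (2 * \<epsilon> n) + E (x n - z))"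
        using est[OF yS x(1) ys xs, of n] const_nonneg by (intro mult_left_mono) auto
      finally show ?thesis .
    qed
    have "(\<lambda>n. E (y n - z)) \<longlonglongrightarrow> 0"
    proof (rule tendsto_sandwich[OF _ _ tendsto_const])
      show "\<forall>\<^sub>F n in sequentially. 0 \<le> E (y n - z)" by (intro always_eventually allI nonneg diff_mem yX z(1))
      show "\<forall>\<^sub>F n in sequentially. E (y n - z) \<le> \<kappa> * (\<kappa> * (2 * \<epsilon> n) + E (x n - z))" using yz by auto
      show "(\<lambda>n. \<kappa> * (\<kappa> * (2 * \<epsilon> n) + E (x n - z))) \<longlonglongrightarrow> 0"
        using tendsto_mult_right_zero[OF tendsto_add_zero[OF lim z(2)], of \<kappa>] by simp
    qed
    then show ?thesis using closed[OF that yC yX z(1)] by simp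
  qed
  then show ?thesis using z by blast
qed

text \<open>\<open>S z w\<close> is the residual of a nonlinear equation at \<open>z\<close>, tested
  with \<open>w\<close>. By Minty's device the residual is evaluated at a test point
  \<open>v\<close> instead of at the unknown, which makes the condition on \<open>z\<close> affine;
  hemicontinuity leads back to the residual at \<open>z\<close>. Coercivity enters only as a bound
  on the points with \<open>S x x \<le> 0\<close>.\<close>

theorem browder_minty:
  fixes S :: "'a \<Rightarrow> 'a \<Rightarrow> real"
  assumes lin: "\<And>v x y a b. v \<in> X \<Longrightarrow> x \<in> X \<Longrightarrow> y \<in> X \<Longrightarrow> S v (a *\<^sub>R x + b *\<^sub>R y) = a * S v x + b * S v y"
    and cont: "\<And>v u. v \<in> X \<Longrightarrow> (\<And>n. u n \<in> X) \<Longrightarrow> (\<lambda>n. E (u n)) \<longlonglongrightarrow> 0 \<Longrightarrow> (\<lambda>n. S v (u n)) \<longlonglongrightarrow> 0"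
    and mono: "\<And>x y. x \<in> X \<Longrightarrow> y \<in> X \<Longrightarrow> S y (x - y) \<le> S x (x - y)"
    and hemi: "\<And>x w. x \<in> X \<Longrightarrow> w \<in> X \<Longrightarrow> ((\<lambda>t. S (x + t *\<^sub>R w) w) \<longlongrightarrow> S x w) (at_right 0)"
    and coer: "\<And>x. x \<in> X \<Longrightarrow> S x x \<le> 0 \<Longrightarrow> E x < R"
  shows "\<exists>z\<in>X. \<forall>w\<in>X. S z w = 0"
proof -
  have scl: "S v (a *\<^sub>R x) = a * S v x" if "v \<in> X" "x \<in> X" for v a x
    using lin[OF that(1) that(2) zero_mem, of a 0] by simp
  have S0: "S v 0 = 0" if "v \<in> X" for v using scl[OF that zero_mem, of 0] by simp
  have sub: "S v (x - y) = S v x - S v y" if "v \<in> X" "x \<in> X" "y \<in> X" for v x y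
    using lin[OF that, of 1 "-1"] by simp
  have R: "0 < R" using coer[OF zero_mem] S0[OF zero_mem] zero by simp
  \<comment> \<open>The sublevel set supplies the common energy bound for the intersection argument.
    The constraint it imposes is lifted at the end, when the solution is found strictly
    inside.\<close>
  define J where "J = {v \<in> X. E v \<le> R}"
  have cJ: "convex J"
  proof (rule convexI)
    fix x y and a b :: real assume *: "x \<in> J" "y \<in> J" "0 \<le> a" "0 \<le> b" "a + b = 1"
    have "E (a *\<^sub>R x + b *\<^sub>R y) \<le> a * E x + b * E y"
      using * convex unfolding J_def convex_on_def by auto
    also have "\<dots> \<le> a * R + b * R" using * by (intro add_mono mult_left_mono) (auto simp: J_def)
    also have "\<dots> = R" using * by (metis distrib_right mult_1)
    finally show "a *\<^sub>R x + b *\<^sub>R y \<in> J" using * by (auto simp: J_def intro: add_mem scale_mem)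
  qed
  define C where "C v = {z \<in> J. 0 \<le> S v (v - z)}" for v
  have "\<exists>z\<in>X. \<forall>v\<in>J. z \<in> C v"
  proof (rule finite_intersection[where M = R])
    fix v assume "v \<in> J"
    then have v: "v \<in> X" by (auto simp: J_def)
    show "convex (C v)"
    proof (rule convexI)
      fix x y and a b :: real assume *: "x \<in> C v" "y \<in> C v" "0 \<le> a" "0 \<le> b" "a + b = 1"
      then have xy: "x \<in> X" "y \<in> X" by (auto simp: C_def J_def)
      have "v = a *\<^sub>R v + b *\<^sub>R v" using * by (metis scaleR_left_distrib scaleR_one)
      then have "v - (a *\<^sub>R x + b *\<^sub>R y) = a *\<^sub>R (v - x) + b *\<^sub>R (v - y)"
        by (metis (no_types, lifting) add_diff_add scaleR_right_diff_distrib)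
      then have "S v (v - (a *\<^sub>R x + b *\<^sub>R y)) = a * S v (v - x) + b * S v (v - y)"
        using lin[OF v diff_mem diff_mem] v xy by simp
      also have "\<dots> \<ge> 0" using * by (auto simp: C_def)
      finally show "a *\<^sub>R x + b *\<^sub>R y \<in> C v"
        using * convexD[OF cJ, of x y a b] by (auto simp: C_def)
    qed
    fix u x assume u: "\<And>n. u n \<in> C v" "\<And>n. u n \<in> X" "x \<in> X" "(\<lambda>n. E (u n - x)) \<longlonglongrightarrow> 0"
    have "E x \<le> R" using lower_semicontinuous[OF u(2,3,4), of R] u(1) by (auto simp: C_def J_def)
    moreover have "(\<lambda>n. S v (v - u n)) \<longlonglongrightarrow> S v (v - x)"
    proof -
      have "(\<lambda>n. S v (v - x) - S v (u n - x)) \<longlonglongrightarrow> S v (v - x) - 0"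
        using u by (intro tendsto_intros cont[OF v] diff_mem)
      moreover have "S v (v - x) - S v (u n - x) = S v (v - u n)" for n
        using u v by (simp add: sub)
      ultimately show ?thesis by simp
    qed
    then have "0 \<le> S v (v - x)"
      by (rule LIMSEQ_le_const) (use u(1) in \<open>auto simp: C_def\<close>)
    ultimately show "x \<in> C v" using u by (auto simp: C_def J_def)
  next
    fix A assume A: "finite A" "A \<subseteq> J"
    show "\<exists>x\<in>X. E x \<le> R \<and> (\<forall>v\<in>A. x \<in> C v)"
    proof (cases "A = {}")
      case True
      then show ?thesis using zero zero_mem R by (intro bexI[of _ 0]) auto
    next
      case False
      have AX: "a \<in> X" if "a \<in> A" for a using A that by (auto simp: J_def)
      \<comment> \<open>Monotonicity is exactly the sign condition of the matrix game. The optimal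
        mixed strategy \<open>l\<close>, read as convex weights, gives a point satisfying all the
        finitely many inequalities.\<close>
      have "0 \<le> S i (i - j) + S j (j - i)" if "i \<in> A" "j \<in> A" for i j
        using mono[OF AX[OF that(1)] AX[OF that(2)]] AX that by (simp add: sub)
      then obtain l where l: "\<forall>i\<in>A. 0 \<le> l i" "sum l A = 1" "\<forall>i\<in>A. 0 \<le> (\<Sum>j\<in>A. S i (i - j) * l j)"
        using monotone_game[OF A(1) False, of "\<lambda>i j. S i (i - j)"] by metis
      define z where "z = (\<Sum>j\<in>A. l j *\<^sub>R j)"
      have zJ: "z \<in> J" unfolding z_def using A l by (intro convex_sum[OF A(1) cJ l(2)]) auto
      have "0 \<le> S i (i - z)" if i: "i \<in> A" for i
      proof -
        have *: "S i (\<Sum>j\<in>B. l j *\<^sub>R j) = (\<Sum>j\<in>B. l j * S i j)" if "B \<subseteq> A" for B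
          using finite_subset[OF that A(1)] that
        proof (induction B rule: finite_induct)
          case empty
          then show ?case using S0 AX i by simp
        next
          case (insert b B)
          have "(\<Sum>j\<in>B. l j *\<^sub>R j) \<in> X"
            using insert by (intro subspace_sum[OF subspace] scale_mem AX) auto
          then show ?case using insert lin[OF AX[OF i] AX[of b], of "\<Sum>j\<in>B. l j *\<^sub>R j" "l b" 1] by simp
        qed
        have "S i (i - z) = S i i - (\<Sum>j\<in>A. l j * S i j)"
          using sub[OF AX[OF i] AX[OF i], of z] zJ *[of A] by (auto simp: z_def J_def)
        also have "\<dots> = (\<Sum>j\<in>A. l j * S i i) - (\<Sum>j\<in>A. l j * S i j)"
          using l(2) by (simp flip: sum_distrib_right)
        also have "\<dots> = (\<Sum>j\<in>A. S i (i - j) * l j)"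
          unfolding sum_subtractf[symmetric] using AX i by (intro sum.cong) (auto simp: sub algebra_simps)
        finally show ?thesis using l i by auto
      qed
      then show ?thesis using zJ by (auto simp: C_def J_def)
    qed
  qed
  \<comment> \<open>Membership of \<open>z\<close> in \<open>J\<close> is contained in each
    \<open>C v\<close>, and the family is nonempty because 0 lies in \<open>J\<close>.\<close>
  then obtain z where zC: "\<And>v. v \<in> J \<Longrightarrow> 0 \<le> S v (v - z)" "z \<in> J"
    using zero zero_mem R by (fastforce simp: C_def J_def)
  then have z: "z \<in> X" by (auto simp: J_def)
  \<comment> \<open>The test point moves along the segment from \<open>z\<close> towards
    \<open>w\<close>; after division by \<open>t\<close>, the limit \<open>t\<close> to 0 replaces
    it by \<open>z\<close> inside the operator.\<close>
  have vi: "0 \<le> S z (w - z)" if w: "w \<in> J" for w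
  proof -
    have wX: "w \<in> X" using w by (auto simp: J_def)
    have "0 \<le> S (z + t *\<^sub>R (w - z)) (w - z)" if t: "0 < t" "t < 1" for t
    proof -
      have e: "z + t *\<^sub>R (w - z) = (1 - t) *\<^sub>R z + t *\<^sub>R w" by (simp add: algebra_simps)
      have vJ: "z + t *\<^sub>R (w - z) \<in> J" unfolding e using t zC w by (intro convexD[OF cJ]) auto
      from zC(1)[OF this] have "0 \<le> t * S (z + t *\<^sub>R (w - z)) (w - z)"
        using scl[OF _ diff_mem[OF wX z], of "z + t *\<^sub>R (w - z)" t] vJ by (auto simp: J_def)
      then show ?thesis using t by (simp add: zero_le_mult_iff)
    qed
    then have "\<forall>\<^sub>F t in at_right 0. 0 \<le> S (z + t *\<^sub>R (w - z)) (w - z)"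
      by (intro eventually_at_rightI[of 0 1]) auto
    with hemi[OF z diff_mem[OF wX z]] show ?thesis
      by (rule tendsto_lowerbound) simp
  qed
  \<comment> \<open>Testing with 0 triggers coercivity, which places \<open>z\<close> strictly
    inside the sublevel set. Every direction is then admissible for small steps, and the inequality
    becomes an equation.\<close>
  have "0 \<le> S z (0 - z)" using vi[of 0] zero zero_mem R by (auto simp: J_def)
  then have "S z z \<le> 0" using sub[OF z zero_mem z] S0[OF z] by simp
  then have ER: "E z < R" using coer z by blast
  have ge: "0 \<le> S z w" if w: "w \<in> X" for w
  proof -
    \<comment> \<open>Chosen so that convexity gives
      \<open>E (z + t *\<^sub>R w) \<le> E z + t * E (z + w) \<le> R\<close>; the \<open>+ 1\<close>
      keeps the denominator positive.\<close>
    define t where "t = min 1 ((R - E z) / (E (z + w) + 1))"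
    have Ezw: "0 \<le> E (z + w)" "0 \<le> E z" using z w by (auto intro: nonneg add_mem)
    have t: "0 < t" "t \<le> 1" using ER Ezw by (auto simp: t_def)
    have "E (z + t *\<^sub>R w) = E ((1 - t) *\<^sub>R z + t *\<^sub>R (z + w))" by (simp add: algebra_simps)
    also have "\<dots> \<le> (1 - t) * E z + t * E (z + w)"
      using convex z w t add_mem unfolding convex_on_def by auto
    also have "\<dots> \<le> 1 * E z + t * (E (z + w) + 1)"
      using t Ezw by (intro add_mono mult_right_mono mult_left_mono) auto
    also have "t * (E (z + w) + 1) \<le> (R - E z) / (E (z + w) + 1) * (E (z + w) + 1)"
      using Ezw by (intro mult_right_mono) (auto simp: t_def)
    also have "\<dots> = R - E z" using Ezw by simp
    finally have "E (z + t *\<^sub>R w) \<le> R" by simp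
    then have "0 \<le> S z (z + t *\<^sub>R w - z)" using z w by (intro vi) (auto simp: J_def intro: add_mem scale_mem)
    then have "0 \<le> t * S z w" using scl[OF z w] by simp
    then show ?thesis using t by (simp add: zero_le_mult_iff)
  qed
  have "S z w = 0" if "w \<in> X" for w
    using ge[OF that] ge[OF scale_mem[OF that, of "-1"]] scl[OF z that, of "-1"] by simp
  then show ?thesis using z by blast
qed

end

subsection \<open>Lebesgue spaces\<close>

lemma convex_on_powr_nonneg:
  assumes "p \<ge> 1" shows "convex_on {0..} (\<lambda>x::real. x powr p)"
proof (rule convex_onI)
  fix t x y :: real
  assume t: "0 < t" "t < 1" and "x \<in> {0..}" "y \<in> {0..}"
  then consider "x = 0" "y = 0" | "x = 0" "y > 0" | "x > 0" "y = 0" | "x > 0" "y > 0"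
    by fastforce
  then show "((1 - t) *\<^sub>R x + t *\<^sub>R y) powr p \<le> (1 - t) * x powr p + t * y powr p"
  proof cases
    case 2
    have "t powr p \<le> t powr 1" using t assms by (intro powr_mono') auto
    then show ?thesis using 2 t assms by (simp add: powr_mult)
  next
    case 3
    have "(1 - t) powr p \<le> (1 - t) powr 1" using t assms by (intro powr_mono') auto
    then show ?thesis using 3 t assms by (simp add: powr_mult)
  next
    case 4
    then show ?thesis
      using convex_onD[OF powr_convex[OF assms], of t x y] t by simp
  qed (use assms in auto)
qed simp

lemma norm_powr_convex:
  fixes x y :: "'b::real_normed_vector"
  assumes "p \<ge> 1" "0 \<le> a" "0 \<le> b" "a + b = 1"
  shows "norm (a *\<^sub>R x + b *\<^sub>R y) powr p \<le> a * norm x powr p + b * norm y powr p"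
proof -
  have "norm (a *\<^sub>R x + b *\<^sub>R y) powr p \<le> (a * norm x + b * norm y) powr p"
    using assms norm_triangle_ineq[of "a *\<^sub>R x" "b *\<^sub>R y"] by (intro powr_mono2) auto
  also have "\<dots> \<le> a * norm x powr p + b * norm y powr p"
    using convex_on_powr_nonneg[OF assms(1)] assms unfolding convex_on_def by auto
  finally show ?thesis .
qed

lemma norm_add_powr_le:
  fixes x y :: "'b::real_normed_vector"
  assumes "p \<ge> 0"
  shows "norm (x + y) powr p \<le> 2 powr p * (norm x powr p + norm y powr p)"
proof -
  let ?m = "max (norm x) (norm y)"
  have "norm (x + y) \<le> 2 * ?m" using norm_triangle_ineq[of x y] by linarith
  then have "norm (x + y) powr p \<le> (2 * ?m) powr p" using assms by (intro powr_mono2) auto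
  also have "\<dots> = 2 powr p * ?m powr p" by (simp add: powr_mult)
  also have "?m powr p \<le> norm x powr p + norm y powr p" by (simp add: max_def)
  finally show ?thesis by simp
qed

lemma powr_superadditive:
  fixes x y :: real
  assumes "x \<ge> 0" "y \<ge> 0" "q \<ge> 1"
  shows "x powr q + y powr q \<le> (x + y) powr q"
proof -
  have split: "z powr q = z * z powr (q - 1)" if "z \<ge> 0" for z :: real
    using that by (cases "z = 0") (auto simp: powr_diff)
  have "x * x powr (q - 1) + y * y powr (q - 1) \<le> x * (x + y) powr (q - 1) + y * (x + y) powr (q - 1)"
    using assms by (intro add_mono mult_left_mono powr_mono2) auto
  then show ?thesis using split assms by (simp add: distrib_right)
qed

text \<open>The parallelogram identity is the case of exponent 2. Raising to the power
  \<open>p / 2 \<ge> 1\<close> preserves the inequality: superadditivity handles the left side and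
  convexity the right.\<close>

lemma clarkson:
  fixes x y :: "'b::real_inner"
  assumes "p \<ge> 2"
  shows "norm ((1/2) *\<^sub>R (x + y)) powr p + norm ((1/2) *\<^sub>R (x - y)) powr p
    \<le> (norm x powr p + norm y powr p) / 2"
proof -
  have sq: "norm z powr p = ((norm z)\<^sup>2) powr (p / 2)" for z :: 'b
    by (cases "z = 0") (auto simp: powr_powr simp flip: powr_numeral)
  have "norm ((1/2) *\<^sub>R (x + y)) powr p + norm ((1/2) *\<^sub>R (x - y)) powr p
    \<le> ((norm ((1/2) *\<^sub>R (x + y)))\<^sup>2 + (norm ((1/2) *\<^sub>R (x - y)))\<^sup>2) powr (p / 2)"
    unfolding sq using assms by (intro powr_superadditive) auto
  also have "(norm ((1/2) *\<^sub>R (x + y)))\<^sup>2 + (norm ((1/2) *\<^sub>R (x - y)))\<^sup>2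
      = (1/2) * (norm x)\<^sup>2 + (1/2) * (norm y)\<^sup>2"
    unfolding power2_norm_eq_inner by (simp add: algebra_simps inner_commute)
  also have "\<dots> powr (p / 2) \<le> (1/2) * ((norm x)\<^sup>2) powr (p / 2) + (1/2) * ((norm y)\<^sup>2) powr (p / 2)"
    using convex_onD[OF convex_on_powr_nonneg[of "p / 2"], of "1/2" "(norm x)\<^sup>2" "(norm y)\<^sup>2"] assms by simp
  finally show ?thesis unfolding sq by simp
qed

section \<open>Lebesgue spaces and their energies\<close>

definition Lp :: "real \<Rightarrow> 'a measure \<Rightarrow> ('a \<Rightarrow> 'b::euclidean_space) set" where
  "Lp p M = {f \<in> borel_measurable M. integrable M (\<lambda>x. norm (f x) powr p)}"

text \<open>The root of the norm is omitted so that pointwise inequalities, such as convexity or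
  Clarkson's, pass to it by mere integration.\<close>

definition energy :: "real \<Rightarrow> 'a measure \<Rightarrow> ('a \<Rightarrow> 'b::euclidean_space) \<Rightarrow> real" where
  "energy p M f = (LINT x|M. norm (f x) powr p)"

lemma LpD:
  assumes "f \<in> Lp p M"
  shows "f \<in> borel_measurable M" "integrable M (\<lambda>x. norm (f x) powr p)"
  using assms by (auto simp: Lp_def)

lemma Lp_dominated:
  assumes "integrable M g" "f \<in> borel_measurable M" "\<And>x. x \<in> space M \<Longrightarrow> norm (f x) powr p \<le> g x"
  shows "f \<in> Lp p M"
proof -
  note [measurable] = assms(2)
  have "integrable M (\<lambda>x. norm (f x) powr p)"
  proof (rule Bochner_Integration.integrable_bound[OF assms(1)])
    show "AE x in M. norm (norm (f x) powr p) \<le> norm (g x)"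
    proof (rule AE_I2)
      fix x assume "x \<in> space M"
      from assms(3)[OF this] show "norm (norm (f x) powr p) \<le> norm (g x)" by auto
    qed
  qed simp
  then show ?thesis using assms(2) by (simp add: Lp_def)
qed

lemma energy_nonneg: "0 \<le> energy p M f"
  unfolding energy_def by simp

lemma energy_scaleR: "energy p M (c *\<^sub>R f) = \<bar>c\<bar> powr p * energy p M f"
  unfolding energy_def by (simp add: powr_mult)

lemma Lp_0: "0 \<in> Lp p M"
  by (auto simp: Lp_def zero_fun_def)

lemma Lp_scaleR: "f \<in> Lp p M \<Longrightarrow> c *\<^sub>R f \<in> Lp p M"
  by (auto simp: Lp_def scaleR_fun_def powr_mult)

lemma Lp_add:
  assumes "p \<ge> 0" "f \<in> Lp p M" "g \<in> Lp p M" shows "f + g \<in> Lp p M"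
proof (rule Lp_dominated[where g = "\<lambda>x. 2 powr p * (norm (f x) powr p + norm (g x) powr p)"])
  show "integrable M (\<lambda>x. 2 powr p * (norm (f x) powr p + norm (g x) powr p))"
    using LpD[OF assms(2)] LpD[OF assms(3)] by auto
  show "f + g \<in> borel_measurable M" 
    unfolding plus_fun_def using LpD[OF assms(2)] LpD[OF assms(3)] by auto
qed (auto intro: norm_add_powr_le assms)

lemma subspace_Lp: "p \<ge> 0 \<Longrightarrow> subspace (Lp p M)"
  unfolding subspace_def by (auto intro: Lp_0 Lp_scaleR Lp_add)

lemma Lp_diff:
  assumes "p \<ge> 0" "f \<in> Lp p M" "g \<in> Lp p M" shows "f - g \<in> Lp p M"
  using subspace_diff[OF subspace_Lp[OF assms(1)] assms(2,3)] .

lemma energy_add_le: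
  assumes "p \<ge> 0" "f \<in> Lp p M" "g \<in> Lp p M"
  shows "energy p M (f + g) \<le> 2 powr p * (energy p M f + energy p M g)"
proof -
  have "energy p M (f + g) \<le> (LINT x|M. 2 powr p * (norm (f x) powr p + norm (g x) powr p))"
    unfolding energy_def using LpD[OF assms(2)] LpD[OF assms(3)] LpD(2)[OF Lp_add[OF assms]]
    by (intro integral_mono) (auto intro: norm_add_powr_le assms)
  also have "\<dots> = 2 powr p * (energy p M f + energy p M g)"
    unfolding energy_def using LpD[OF assms(2)] LpD[OF assms(3)] by simp
  finally show ?thesis .
qed

lemma convex_on_energy:
  assumes "p \<ge> 1" shows "convex_on (Lp p M) (energy p M)"
  unfolding convex_on_def
proof (intro conjI ballI allI impI)
  show "convex (Lp p M)" using assms by (intro subspace_imp_convex subspace_Lp) auto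
  fix f g :: "'a \<Rightarrow> 'b" and a b :: real
  assume *: "f \<in> Lp p M" "g \<in> Lp p M" "0 \<le> a" "0 \<le> b" "a + b = 1"
  have "energy p M (a *\<^sub>R f + b *\<^sub>R g) \<le> (LINT x|M. a * norm (f x) powr p + b * norm (g x) powr p)"
    unfolding energy_def using * LpD[OF *(1)] LpD[OF *(2)] assms
      LpD(2)[OF Lp_add[OF _ Lp_scaleR[OF *(1), of a] Lp_scaleR[OF *(2), of b]]]
    by (intro integral_mono) (auto intro: norm_powr_convex)
  also have "\<dots> = a * energy p M f + b * energy p M g"
    unfolding energy_def using LpD[OF *(1)] LpD[OF *(2)] by simp
  finally show "energy p M (a *\<^sub>R f + b *\<^sub>R g) \<le> a * energy p M f + b * energy p M g" .
qed

text \<open>Clarkson's inequality, integrated, controls half the difference. Doubling costs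
  \<open>2 powr p\<close>, which is also the constant in \<open>energy_add_le\<close>, so a single
  \<open>\<kappa>\<close> serves for both.\<close>

lemma energy_uniformly_convex:
  assumes "p \<ge> 2" "f \<in> Lp p M" "g \<in> Lp p M"
  shows "energy p M (f - g) \<le> 2 powr p * ((energy p M f + energy p M g) / 2 - energy p M ((1/2) *\<^sub>R (f + g)))"
proof -
  have L: "(1/2) *\<^sub>R (f + g) \<in> Lp p M" "(1/2) *\<^sub>R (f - g) \<in> Lp p M"
    using assms by (auto intro!: Lp_scaleR Lp_add Lp_diff)
  have "energy p M ((1/2) *\<^sub>R (f + g)) + energy p M ((1/2) *\<^sub>R (f - g))
      = (LINT x|M. norm (((1/2) *\<^sub>R (f + g)) x) powr p + norm (((1/2) *\<^sub>R (f - g)) x) powr p)"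
    unfolding energy_def using LpD(2)[OF L(1)] LpD(2)[OF L(2)] by simp
  also have "\<dots> \<le> (LINT x|M. (norm (f x) powr p + norm (g x) powr p) / 2)"
    using LpD(2)[OF L(1)] LpD(2)[OF L(2)] LpD(2)[OF assms(2)] LpD(2)[OF assms(3)] clarkson[OF assms(1)]
    by (intro integral_mono Bochner_Integration.integrable_add) auto
  also have "\<dots> = (energy p M f + energy p M g) / 2"
    unfolding energy_def using LpD(2)[OF assms(2)] LpD(2)[OF assms(3)] by simp
  finally have "energy p M ((1/2) *\<^sub>R (f - g)) \<le> (energy p M f + energy p M g) / 2 - energy p M ((1/2) *\<^sub>R (f + g))"
    by linarith
  moreover have "energy p M (f - g) = 2 powr p * energy p M ((1/2) *\<^sub>R (f - g))"
    using energy_scaleR[of p M 2 "(1/2) *\<^sub>R (f - g)"] by simp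
  ultimately show ?thesis by (metis mult_left_mono powr_ge_zero)
qed

section \<open>Completeness and lower semicontinuity\<close>

lemma fatou_bound:
  fixes g :: "nat \<Rightarrow> 'a \<Rightarrow> real"
  assumes g: "\<And>n. integrable M (g n)" "\<And>n x. 0 \<le> g n x"
    and f: "f \<in> borel_measurable M" "AE x in M. (\<lambda>n. g n x) \<longlonglongrightarrow> f x"
    and c: "\<forall>\<^sub>F n in sequentially. integral\<^sup>L M (g n) \<le> c"
  shows "integrable M f" "integral\<^sup>L M f \<le> c"
proof -
  have nn: "AE x in M. 0 \<le> f x"
    using f(2) by eventually_elim (use g(2) in \<open>auto intro!: LIMSEQ_le_const\<close>)
  have [measurable]: "g n \<in> borel_measurable M" for n using g(1) by auto
  have "(\<integral>\<^sup>+x. ennreal (f x) \<partial>M) = (\<integral>\<^sup>+x. liminf (\<lambda>n. ennreal (g n x)) \<partial>M)"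
    using f(2) by (intro nn_integral_cong_AE) (auto simp: lim_imp_Liminf[OF _ tendsto_ennrealI])
  also have "\<dots> \<le> liminf (\<lambda>n. \<integral>\<^sup>+x. ennreal (g n x) \<partial>M)"
    by (intro nn_integral_liminf) simp
  also have "\<dots> \<le> limsup (\<lambda>n. \<integral>\<^sup>+x. ennreal (g n x) \<partial>M)"
    by (intro Liminf_le_Limsup) simp
  also have "\<dots> \<le> ennreal c"
  proof (rule Limsup_bounded)
    show "\<forall>\<^sub>F n in sequentially. (\<integral>\<^sup>+x. ennreal (g n x) \<partial>M) \<le> ennreal c"
      using c by eventually_elim (simp add: nn_integral_eq_integral g ennreal_leI)
  qed
  finally have le: "(\<integral>\<^sup>+x. ennreal (f x) \<partial>M) \<le> ennreal c" .
  then show int: "integrable M f"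
    using f(1) nn by (intro integrableI_nonneg) (auto simp: le_less_trans)
  obtain n where "integral\<^sup>L M (g n) \<le> c" using c by (auto simp: eventually_sequentially)
  moreover have "0 \<le> integral\<^sup>L M (g n)" using g by simp
  ultimately have "0 \<le> c" by linarith
  then show "integral\<^sup>L M f \<le> c"
    using le nn_integral_eq_integral[OF int nn] by simp
qed

text \<open>Riesz-Fischer: a fast subsequence converges almost everywhere, and Fatou's lemma turns
  the pointwise limit into a limit in energy.\<close>

lemma Lp_complete:
  fixes u :: "nat \<Rightarrow> 'a \<Rightarrow> 'b::euclidean_space"
  assumes p: "p > 0" and u: "\<And>n. u n \<in> Lp p M"
    and cauchy: "\<And>e. e > 0 \<Longrightarrow> \<exists>N. \<forall>m\<ge>N. \<forall>n\<ge>N. energy p M (u m - u n) < e"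
  shows "\<exists>v\<in>Lp p M. (\<lambda>n. energy p M (u n - v)) \<longlonglongrightarrow> 0"
proof -
  have [measurable]: "u n \<in> borel_measurable M" for n using u LpD by blast
  have uu: "u m - u n \<in> Lp p M" for m n using u p by (intro Lp_diff) auto
  \<comment> \<open>The factor \<open>1/4\<close> leaves room for the weights
    \<open>(2 powr p) ^ k\<close> in \<open>g\<close>: the weighted integrals remain summable, and
    at almost every point the weighted terms tend to 0, which forces increments of at most
    \<open>(1/2) ^ k\<close> eventually.\<close>
  define \<delta> where "\<delta> k = ((1/4) powr p) ^ k" for k :: nat
  have "\<exists>N. \<forall>m\<ge>N. \<forall>n\<ge>N. energy p M (u m - u n) < \<delta> k" for k
    by (rule cauchy) (simp add: \<delta>_def)
  then obtain N where N: "\<And>k m n. m \<ge> N k \<Longrightarrow> n \<ge> N k \<Longrightarrow> energy p M (u m - u n) < \<delta> k" by metis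
  define r where "r k = (\<Sum>j\<le>k. N j)" for k
  have rN: "r k \<ge> N k" for k unfolding r_def by (intro member_le_sum) auto
  have rmono: "r j \<le> r k" if "j \<le> k" for j k unfolding r_def using that by (intro sum_mono2) auto
  define g where "g k x = (2 powr p) ^ k * norm (u (r (Suc k)) x - u (r k) x) powr p" for k x
  have g0: "g k x \<ge> 0" for k x by (simp add: g_def)
  have gint: "integrable M (g k)" for k
    using LpD(2)[OF uu[of "r (Suc k)" "r k"]] unfolding g_def by simp
  have gle: "integral\<^sup>L M (g k) \<le> ((1/2) powr p) ^ k" for k
  proof -
    have "integral\<^sup>L M (g k) = (2 powr p) ^ k * energy p M (u (r (Suc k)) - u (r k))"
      unfolding g_def energy_def by simp
    also have "\<dots> \<le> (2 powr p) ^ k * \<delta> k"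
      using N[of k "r (Suc k)" "r k"] rN[of k] rmono[of k "Suc k"] by (intro mult_left_mono) auto
    also have "\<dots> = ((1/2) powr p) ^ k"
      unfolding \<delta>_def power_mult_distrib[symmetric] powr_mult[symmetric] by simp
    finally show ?thesis .
  qed
  have half: "(1/2) powr p < (1::real)" using powr_less_mono2[of p "1/2" 1] p by simp
  have "(\<integral>\<^sup>+x. (\<Sum>k. ennreal (g k x)) \<partial>M) = (\<Sum>k. \<integral>\<^sup>+x. ennreal (g k x) \<partial>M)"
    by (intro nn_integral_suminf) (simp add: g_def)
  also have "\<dots> \<le> (\<Sum>k. ennreal (((1/2) powr p) ^ k))"
    using gle by (intro suminf_le) (auto simp: nn_integral_eq_integral gint g0 ennreal_leI)
  also have "\<dots> = ennreal (\<Sum>k. ((1/2) powr p) ^ k)"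
    using half by (intro suminf_ennreal2) auto
  finally have "(\<integral>\<^sup>+x. (\<Sum>k. ennreal (g k x)) \<partial>M) \<noteq> \<infinity>" by (auto simp: top_unique)
  then have "AE x in M. (\<Sum>k. ennreal (g k x)) \<noteq> \<infinity>"
    by (intro nn_integral_PInf_AE) (auto simp: g_def)
  then have conv: "AE x in M. convergent (\<lambda>k. u (r k) x)"
  proof eventually_elim
    fix x assume "(\<Sum>k. ennreal (g k x)) \<noteq> \<infinity>"
    then have "summable (\<lambda>k. g k x)" by (intro summable_suminf_not_top g0) auto
    then have "(\<lambda>k. g k x) \<longlonglongrightarrow> 0" by (rule summable_LIMSEQ_zero)
    then have "\<forall>\<^sub>F k in sequentially. g k x < 1" by (rule order_tendstoD) simp
    then have "\<forall>\<^sub>F k in sequentially. norm (u (r (Suc k)) x - u (r k) x) \<le> (1/2) ^ k"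
    proof eventually_elim
      fix k assume g1: "g k x < 1"
      have "g k x = (2 ^ k * norm (u (r (Suc k)) x - u (r k) x)) powr p"
        by (simp add: g_def powr_mult powr_realpow[symmetric] powr_powr mult.commute)
      then have "2 ^ k * norm (u (r (Suc k)) x - u (r k) x) \<le> 1"
        using g1 powr_mono2[of p 1 "2 ^ k * norm (u (r (Suc k)) x - u (r k) x)"] p by (smt (verit) powr_one_eq_one)
      then show "norm (u (r (Suc k)) x - u (r k) x) \<le> (1/2) ^ k"
        by (simp add: field_simps power_divide)
    qed
    then have "summable (\<lambda>k. u (r (Suc k)) x - u (r k) x)"
      by (rule summable_comparison_test_ev) (simp add: summable_geometric)
    then have "convergent (\<lambda>n. \<Sum>k<n. u (r (Suc k)) x - u (r k) x)"
      by (simp add: summable_iff_convergent)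
    then have "convergent (\<lambda>n. u (r n) x - u (r 0) x)"
      by (subst (asm) sum_lessThan_telescope)
    then have "convergent (\<lambda>n. (u (r n) x - u (r 0) x) + u (r 0) x)"
      by (intro convergent_add convergent_const)
    then show "convergent (\<lambda>k. u (r k) x)" by simp
  qed
  define v where "v x = lim (\<lambda>k. u (r k) x)" for x
  have v[measurable]: "v \<in> borel_measurable M" unfolding v_def by measurable
  have lim: "AE x in M. (\<lambda>k. u (r k) x) \<longlonglongrightarrow> v x"
    using conv by eventually_elim (simp add: v_def convergent_LIMSEQ_iff)
  \<comment> \<open>With \<open>m\<close> fixed, Fatou's lemma along the subsequence passes the
    Cauchy bound to the limit, and places \<open>u m - v\<close>, hence \<open>v\<close>, in the
    space.\<close>
  have key: "u m - v \<in> Lp p M \<and> energy p M (u m - v) \<le> \<delta> k" if m: "m \<ge> N k" for m k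
  proof -
    have A: "AE x in M. (\<lambda>j. norm ((u m - u (r j)) x) powr p) \<longlonglongrightarrow> norm ((u m - v) x) powr p"
      using lim
    proof eventually_elim
      fix x assume "(\<lambda>k. u (r k) x) \<longlonglongrightarrow> v x"
      then show "(\<lambda>j. norm ((u m - u (r j)) x) powr p) \<longlonglongrightarrow> norm ((u m - v) x) powr p"
        using p by (auto intro!: tendsto_intros tendsto_powr')
    qed
    have B: "\<forall>\<^sub>F j in sequentially. (LINT x|M. norm ((u m - u (r j)) x) powr p) \<le> \<delta> k"
    proof (rule eventually_sequentiallyI)
      fix j assume "k \<le> j"
      then have "N k \<le> r j" using rN[of k] rmono[of k j] by simp
      then show "(LINT x|M. norm ((u m - u (r j)) x) powr p) \<le> \<delta> k"
        using N[OF m] unfolding energy_def by (simp add: less_imp_le)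
    qed
    have "integrable M (\<lambda>x. norm ((u m - v) x) powr p)" "(LINT x|M. norm ((u m - v) x) powr p) \<le> \<delta> k"
      using fatou_bound[OF LpD(2)[OF uu] _ _ A B] by auto
    then show ?thesis unfolding Lp_def energy_def by (auto simp: fun_diff_def)
  qed
  have "v = u (N 0) - (u (N 0) - v)" by simp
  then have vL: "v \<in> Lp p M" using Lp_diff[OF _ u conjunct1[OF key[of 0 "N 0"]]] p by (metis less_imp_le order_refl)
  have "(\<lambda>n. energy p M (u n - v)) \<longlonglongrightarrow> 0"
  proof (rule LIMSEQ_I)
    fix e :: real assume "e > 0"
    have "\<delta> \<longlonglongrightarrow> 0" unfolding \<delta>_def using powr_less_mono2[of p "1/4" 1] p by (intro LIMSEQ_realpow_zero) auto
    then have "\<forall>\<^sub>F k in sequentially. \<delta> k < e" using \<open>e > 0\<close> by (rule order_tendstoD(2))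
    then obtain k where "\<delta> k < e" by (auto simp: eventually_sequentially)
    then show "\<exists>no. \<forall>n\<ge>no. norm (energy p M (u n - v) - 0) < e"
      using key by (intro exI[of _ "N k"]) (auto simp: energy_nonneg intro: le_less_trans)
  qed
  then show ?thesis using vL by blast
qed

text \<open>A convexity argument in place of Minkowski's inequality: \<open>v\<close> is a convex
  combination, with weights \<open>1 - t\<close> and \<open>t\<close>, of multiples of
  \<open>u n\<close> and of \<open>u n - v\<close>. For fixed \<open>t\<close> the second part
  vanishes as \<open>n\<close> grows, however large its factor; only then does \<open>t\<close> tend
  to 0.\<close>

lemma energy_lower_semicontinuous:
  fixes u :: "nat \<Rightarrow> 'a \<Rightarrow> 'b::euclidean_space"
  assumes p: "p \<ge> 1" and u: "\<And>n. u n \<in> Lp p M" and v: "v \<in> Lp p M"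
    and lim: "(\<lambda>n. energy p M (u n - v)) \<longlonglongrightarrow> 0" and R: "\<And>n. energy p M (u n) \<le> R"
  shows "energy p M v \<le> R"
proof -
  have *: "energy p M v \<le> (1 - t) * ((1 / (1 - t)) powr p * R)" if t: "0 < t" "t < 1" for t
  proof -
    have "energy p M v \<le> (1 - t) * ((1 / (1 - t)) powr p * R) + t * ((1 / t) powr p * energy p M (u n - v))" for n
    proof -
      have "v = (1 - t) *\<^sub>R ((1 / (1 - t)) *\<^sub>R u n) + t *\<^sub>R ((- 1 / t) *\<^sub>R (u n - v))"
        using t by (simp add: algebra_simps)
      then have "energy p M v = energy p M ((1 - t) *\<^sub>R ((1 / (1 - t)) *\<^sub>R u n) + t *\<^sub>R ((- 1 / t) *\<^sub>R (u n - v)))" by simp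
      also have "\<dots> \<le> (1 - t) * energy p M ((1 / (1 - t)) *\<^sub>R u n) + t * energy p M ((- 1 / t) *\<^sub>R (u n - v))"
        using t u p Lp_diff[OF _ u v] by (intro convex_onD[OF convex_on_energy[OF p]] Lp_scaleR) auto
      also have "\<dots> = (1 - t) * ((1 / (1 - t)) powr p * energy p M (u n)) + t * ((1 / t) powr p * energy p M (u n - v))"
        using t by (simp only: energy_scaleR) simp
      also have "\<dots> \<le> (1 - t) * ((1 / (1 - t)) powr p * R) + t * ((1 / t) powr p * energy p M (u n - v))"
        using t R by (intro add_mono mult_left_mono) auto
      finally show ?thesis .
    qed
    moreover have "(\<lambda>n. (1 - t) * ((1 / (1 - t)) powr p * R) + t * ((1 / t) powr p * energy p M (u n - v)))
        \<longlonglongrightarrow> (1 - t) * ((1 / (1 - t)) powr p * R) + t * ((1 / t) powr p * 0)"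
      by (intro tendsto_intros lim)
    ultimately show ?thesis using LIMSEQ_le_const by force
  qed
  have "((\<lambda>t. (1 - t) * ((1 / (1 - t)) powr p * R)) \<longlongrightarrow> (1 - 0) * ((1 / (1 - 0)) powr p * R)) (at_right 0)"
    by (intro tendsto_intros) auto
  then show ?thesis
    by (rule tendsto_lowerbound[where a = "energy p M v", THEN order_trans])
       (use * in \<open>auto intro!: eventually_at_rightI[of 0 1]\<close>)
qed

lemma uniformly_convex_energy_Lp:
  assumes p: "p \<ge> 2" and K: "subspace K" "K \<subseteq> Lp p M"
    and closed: "\<And>u v. (\<And>n::nat. u n \<in> K) \<Longrightarrow> v \<in> Lp p M \<Longrightarrow> (\<lambda>n. energy p M (u n - v)) \<longlonglongrightarrow> 0 \<Longrightarrow> v \<in> K"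
  shows "uniformly_convex_energy K (energy p M) (2 powr p)"
proof
  show "convex_on K (energy p M)"
    using convex_on_energy[of p M] p K by (intro convex_on_subset[OF _ K(2)] subspace_imp_convex) auto
  show "energy p M 0 = 0" by (simp add: energy_def)
  fix u :: "nat \<Rightarrow> _"
  assume u: "\<And>n. u n \<in> K" and "\<And>e. e > 0 \<Longrightarrow> \<exists>N. \<forall>m\<ge>N. \<forall>n\<ge>N. energy p M (u m - u n) < e"
  then have "\<exists>v\<in>Lp p M. (\<lambda>n. energy p M (u n - v)) \<longlonglongrightarrow> 0" using p K by (intro Lp_complete) auto
  then show "\<exists>v\<in>K. (\<lambda>n. energy p M (u n - v)) \<longlonglongrightarrow> 0" using closed u by blast
next
  fix u v R assume "\<And>n::nat. u n \<in> K" "v \<in> K" "(\<lambda>n. energy p M (u n - v)) \<longlonglongrightarrow> 0" "\<And>n. energy p M (u n) \<le> R"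
  then show "energy p M v \<le> R" using p K by (intro energy_lower_semicontinuous[of p u M v R]) auto
qed (use p K in \<open>auto simp: energy_nonneg intro: energy_uniformly_convex energy_add_le\<close>)

section \<open>Hoelder's inequality and superposition operators\<close>

lemma energy_eq_0_AE:
  assumes "f \<in> Lp p M" "energy p M f = 0" shows "AE x in M. f x = 0"
proof -
  have "AE x in M. norm (f x) powr p = 0"
    using assms(2) unfolding energy_def by (subst (asm) integral_nonneg_eq_0_iff_AE[OF LpD(2)[OF assms(1)]]) auto
  then show ?thesis by eventually_elim simp
qed

text \<open>Young's inequality is integrated after normalising both factors to unit energy. A factor
  of zero energy cannot be normalised, but it vanishes almost everywhere.\<close>

lemma holder:
  fixes f :: "'a \<Rightarrow> 'b::euclidean_space" and g :: "'a \<Rightarrow> 'c::euclidean_space"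
  assumes pq: "p > 1" "q > 1" "1 / p + 1 / q = 1" and f: "f \<in> Lp p M" and g: "g \<in> Lp q M"
  shows "integrable M (\<lambda>x. norm (f x) * norm (g x))"
    and "(LINT x|M. norm (f x) * norm (g x)) \<le> energy p M f powr (1 / p) * energy q M g powr (1 / q)"
proof -
  note [measurable] = LpD(1)[OF f] LpD(1)[OF g]
  note int = LpD(2)[OF f] LpD(2)[OF g]
  show I: "integrable M (\<lambda>x. norm (f x) * norm (g x))"
  proof (rule Bochner_Integration.integrable_bound)
    show "integrable M (\<lambda>x. norm (f x) powr p / p + norm (g x) powr q / q)" using int by auto
    show "AE x in M. norm (norm (f x) * norm (g x)) \<le> norm (norm (f x) powr p / p + norm (g x) powr q / q)"
      using Youngs_inequality[OF pq] by (auto intro!: AE_I2 order_trans[OF _ abs_ge_self])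
  qed simp
  define A B where "A = energy p M f" and "B = energy q M g"
  have AB0: "A \<ge> 0" "B \<ge> 0" by (auto simp: A_def B_def energy_nonneg)
  show "(LINT x|M. norm (f x) * norm (g x)) \<le> energy p M f powr (1 / p) * energy q M g powr (1 / q)"
  proof (cases "A = 0 \<or> B = 0")
    case True
    then have "AE x in M. norm (f x) * norm (g x) = 0"
    proof
      assume "A = 0"
      then have "AE x in M. f x = 0" using f by (auto simp: A_def intro: energy_eq_0_AE)
      then show ?thesis by eventually_elim simp
    next
      assume "B = 0"
      then have "AE x in M. g x = 0" using g by (auto simp: B_def intro: energy_eq_0_AE)
      then show ?thesis by eventually_elim simp
    qed
    then have "(LINT x|M. norm (f x) * norm (g x)) = 0"
      by (subst integral_cong_AE[where g = "\<lambda>_. 0"]) auto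
    then show ?thesis by simp
  next
    case False
    then have AB: "A > 0" "B > 0" using AB0 by auto
    define a b where "a = A powr (1 / p)" and "b = B powr (1 / q)"
    have ab: "a > 0" "b > 0" "a powr p = A" "b powr q = B"
      using AB pq by (auto simp: a_def b_def powr_powr)
    have "(LINT x|M. norm (f x) * norm (g x)) / (a * b) = (LINT x|M. (norm (f x) / a) * (norm (g x) / b))"
      by simp
    also have "\<dots> \<le> (LINT x|M. norm (f x) powr p / (A * p) + norm (g x) powr q / (B * q))"
    proof (rule integral_mono)
      show "integrable M (\<lambda>x. (norm (f x) / a) * (norm (g x) / b))" using I by simp
      show "integrable M (\<lambda>x. norm (f x) powr p / (A * p) + norm (g x) powr q / (B * q))" using int by simp
      fix x
      show "(norm (f x) / a) * (norm (g x) / b) \<le> norm (f x) powr p / (A * p) + norm (g x) powr q / (B * q)"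
        using Youngs_inequality[OF pq, of "norm (f x) / a" "norm (g x) / b"] ab
        by (simp add: powr_divide)
    qed
    also have "\<dots> = A / (A * p) + B / (B * q)"
      using int unfolding A_def B_def energy_def by simp
    also have "\<dots> = 1" using AB pq by simp
    finally show ?thesis using ab by (simp add: field_simps a_def b_def A_def B_def)
  qed
qed

lemma holder_inner:
  fixes f g :: "'a \<Rightarrow> 'b::euclidean_space"
  assumes pq: "p > 1" "q > 1" "1 / p + 1 / q = 1" and f: "f \<in> Lp p M" and g: "g \<in> Lp q M"
  shows "integrable M (\<lambda>x. f x \<bullet> g x)"
    and "\<bar>LINT x|M. f x \<bullet> g x\<bar> \<le> energy p M f powr (1 / p) * energy q M g powr (1 / q)"
proof -
  note [measurable] = LpD(1)[OF f] LpD(1)[OF g]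
  note H = holder[OF assms]
  show I: "integrable M (\<lambda>x. f x \<bullet> g x)"
    by (rule Bochner_Integration.integrable_bound[OF H(1)]) (auto simp: Cauchy_Schwarz_ineq2)
  have "\<bar>LINT x|M. f x \<bullet> g x\<bar> \<le> (LINT x|M. \<bar>f x \<bullet> g x\<bar>)"
    using integral_norm_bound[of M "\<lambda>x. f x \<bullet> g x"] by simp
  also have "\<dots> \<le> (LINT x|M. norm (f x) * norm (g x))"
    using I H(1) by (intro integral_mono) (auto simp: Cauchy_Schwarz_ineq2)
  also note H(2)
  finally show "\<bar>LINT x|M. f x \<bullet> g x\<bar> \<le> energy p M f powr (1 / p) * energy q M g powr (1 / q)" .
qed

lemma conjugate_exponent:
  fixes p :: real
  assumes "p > 1"
  shows "p / (p - 1) > 1" "1 / (p / (p - 1)) + 1 / p = 1" "(p - 1) * (p / (p - 1)) = p"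
  using assms by (auto simp: field_simps)

text \<open>The absorption step behind two a priori bounds: coercivity in the monotone equation, and
  the uniform estimate for truncations in the dual Riesz theorem.\<close>

lemma le_powr_conjugate:
  fixes e D :: real
  assumes pq: "p > 1" "q > 1" "1 / p + 1 / q = 1" and "e \<ge> 0" "D \<ge> 0" and le: "e \<le> D * e powr (1 / p)"
  shows "e \<le> D powr q"
proof (cases "e = 0")
  case False
  then have "e > 0" using \<open>e \<ge> 0\<close> by simp
  have "1 / q = 1 - 1 / p" using pq(3) by simp
  then have "e powr (1 / q) = e / e powr (1 / p)"
    using powr_diff[of e 1 "1 / p"] \<open>e > 0\<close> by simp
  also have "\<dots> \<le> D" using le \<open>e > 0\<close> by (simp add: divide_le_eq)
  finally have "(e powr (1 / q)) powr q \<le> D powr q" using pq by (intro powr_mono2) auto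
  then show ?thesis using \<open>e > 0\<close> pq by (simp add: powr_powr)
qed simp

text \<open>Growth of order \<open>p - 1\<close> matches the conjugate exponent because
  \<open>(p - 1) * (p / (p - 1)) = p\<close>; finiteness of the measure absorbs the constant
  term.\<close>

lemma nemytskii_Lp:
  fixes F :: "'b::euclidean_space \<Rightarrow> 'c::euclidean_space"
  assumes M: "finite_measure M" and p: "p > 1" and F: "F \<in> borel_measurable borel"
    and C: "\<And>y. norm (F y) \<le> C * (1 + norm y powr (p - 1))" and f: "f \<in> Lp p M"
  shows "(\<lambda>x. F (f x)) \<in> Lp (p / (p - 1)) M"
proof (rule Lp_dominated)
  interpret finite_measure M by fact
  define r where "r = p / (p - 1)"
  note r = conjugate_exponent[OF p, folded r_def]
  have C0: "C \<ge> 0" using C[of 0] p by (auto intro: order_trans[OF norm_ge_zero])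
  note [measurable] = F LpD(1)[OF f]
  show "integrable M (\<lambda>x. C powr r * (2 powr r * (1 + norm (f x) powr p)))"
    using LpD(2)[OF f] by auto
  show "(\<lambda>x. F (f x)) \<in> borel_measurable M" by measurable
  fix x
  have "norm (F (f x)) powr (p / (p - 1)) \<le> (C * (1 + norm (f x) powr (p - 1))) powr r"
    unfolding r_def[symmetric] using C r by (intro powr_mono2) auto
  also have "\<dots> = C powr r * norm (1 + norm (f x) powr (p - 1)) powr r" by (simp add: powr_mult)
  also have "\<dots> \<le> C powr r * (2 powr r * (1 + norm (f x) powr p))"
    using norm_add_powr_le[of r "1::real" "norm (f x) powr (p - 1)"] r
    by (intro mult_left_mono) (auto simp: powr_powr)
  finally show "norm (F (f x)) powr (p / (p - 1)) \<le> C powr r * (2 powr r * (1 + norm (f x) powr p))" .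
qed

text \<open>The shift \<open>u0\<close> keeps the unknown in a linear subspace although the fields
  sought form an affine one. Coercivity is required only relative to this base point, a form that
  suits both the flux on divergence-free fields and the power map at base point 0.\<close>

theorem monotone_Lp_solve:
  fixes F :: "'b::euclidean_space \<Rightarrow> 'b" and l :: "('a \<Rightarrow> 'b) \<Rightarrow> real"
  assumes M: "finite_measure M" and p: "p \<ge> 2" and F: "continuous_on UNIV F"
    and C: "\<And>y. norm (F y) \<le> C * (1 + norm y powr (p - 1))"
    and mono: "\<And>y z. 0 \<le> (F y - F z) \<bullet> (y - z)"
    and u0: "u0 \<in> Lp p M"
    and c: "c > 0" "\<And>x z. c * norm z powr p \<le> (F (u0 x + z) - F (u0 x)) \<bullet> z"
    and K: "subspace K" "K \<subseteq> Lp p M"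
      "\<And>u v. (\<And>n::nat. u n \<in> K) \<Longrightarrow> v \<in> Lp p M \<Longrightarrow> (\<lambda>n. energy p M (u n - v)) \<longlonglongrightarrow> 0 \<Longrightarrow> v \<in> K"
    and lin: "\<And>v w a b. v \<in> K \<Longrightarrow> w \<in> K \<Longrightarrow> l (a *\<^sub>R v + b *\<^sub>R w) = a * l v + b * l w"
    and B: "\<And>v. v \<in> K \<Longrightarrow> \<bar>l v\<bar> \<le> B * energy p M v powr (1 / p)"
  shows "\<exists>z\<in>K. \<forall>v\<in>K. (LINT x|M. F (u0 x + z x) \<bullet> v x) = l v"
proof -
  interpret uniformly_convex_energy K "energy p M" "2 powr p"
    by (rule uniformly_convex_energy_Lp[OF p K])
  have p1: "p > 1" using p by simp
  define r where "r = p / (p - 1)"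
  note r = conjugate_exponent[OF p1, folded r_def]
  have Fm: "F \<in> borel_measurable borel" using F by (rule borel_measurable_continuous_onI)
  have KL: "v \<in> Lp p M" if "v \<in> K" for v using that K by auto
  have FL: "(\<lambda>x. F (u0 x + z x)) \<in> Lp r M" if "z \<in> Lp p M" for z
    using nemytskii_Lp[OF M p1 Fm C Lp_add[OF _ u0 that]] p by (simp add: r_def)
  note FI = holder_inner(1)[OF r(1) p1 r(2) FL]
  note FB = holder_inner(2)[OF r(1) p1 r(2) FL]
  define T where "T z w = (LINT x|M. F (u0 x + z x) \<bullet> w x)" for z w
  have T_lin: "T z (a *\<^sub>R v + b *\<^sub>R w) = a * T z v + b * T z w" if "z \<in> Lp p M" "v \<in> Lp p M" "w \<in> Lp p M" for z v w a b
    using FI[OF that(1,2)] FI[OF that(1,3)] unfolding T_def by (simp add: inner_add_right)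
  have T_sub: "T z (v - w) = T z v - T z w" if "z \<in> Lp p M" "v \<in> Lp p M" "w \<in> Lp p M" for z v w
    using T_lin[OF that, of 1 "-1"] by simp
  have T_diff: "T y w - T z w = (LINT x|M. (F (u0 x + y x) - F (u0 x + z x)) \<bullet> w x)"
    if "y \<in> Lp p M" "z \<in> Lp p M" "w \<in> Lp p M" for y z w
    using FI[OF that(1,3)] FI[OF that(2,3)] unfolding T_def by (simp add: inner_diff_left)
  have FDI: "integrable M (\<lambda>x. (F (u0 x + y x) - F (u0 x + z x)) \<bullet> w x)"
    if "y \<in> Lp p M" "z \<in> Lp p M" "w \<in> Lp p M" for y z w
    using FI[OF that(1,3)] FI[OF that(2,3)] by (simp add: inner_diff_left)
  \<comment> \<open>\<open>B0\<close> is the L^r norm of \<open>F\<close> along \<open>u0\<close>: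
    coercivity is measured from the base point, so the operator at \<open>z = 0\<close> remains on
    the right side. The maximum in \<open>D\<close> provides the sign needed for absorption, and the
    \<open>+ 1\<close> in the radius below gives strictness.\<close>
  define B0 where "B0 = energy r M (\<lambda>x. F (u0 x + (0::'a \<Rightarrow> 'b) x)) powr (1 / r)"
  define D where "D = max 0 ((B + B0) / c)"
  have "\<exists>z\<in>K. \<forall>w\<in>K. T z w - l w = 0"
  proof (rule browder_minty[where R = "D powr r + 1"])
    fix v x y a b assume "v \<in> K" "x \<in> K" "y \<in> K"
    then show "T v (a *\<^sub>R x + b *\<^sub>R y) - l (a *\<^sub>R x + b *\<^sub>R y) = a * (T v x - l x) + b * (T v y - l y)"
      by (simp add: T_lin KL lin algebra_simps)
  next
    fix v and u :: "nat \<Rightarrow> _" assume v: "v \<in> K" and u: "\<And>n. u n \<in> K" and lim: "(\<lambda>n. energy p M (u n)) \<longlonglongrightarrow> 0"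
    show "(\<lambda>n. T v (u n) - l (u n)) \<longlonglongrightarrow> 0"
    proof (rule Lim_null_comparison)
      let ?A = "energy r M (\<lambda>x. F (u0 x + v x)) powr (1 / r)"
      show "\<forall>\<^sub>F n in sequentially. norm (T v (u n) - l (u n)) \<le> ?A * energy p M (u n) powr (1 / p) + B * energy p M (u n) powr (1 / p)"
      proof (intro always_eventually allI)
        fix n
        show "norm (T v (u n) - l (u n)) \<le> ?A * energy p M (u n) powr (1 / p) + B * energy p M (u n) powr (1 / p)"
          using FB[OF KL[OF v] KL[OF u], of n] B[OF u, of n] unfolding T_def real_norm_def by linarith
      qed
      have "(\<lambda>n. energy p M (u n) powr (1 / p)) \<longlonglongrightarrow> 0 powr (1 / p)"
        using lim p by (intro tendsto_powr') (auto simp: energy_nonneg)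
      then have "(\<lambda>n. energy p M (u n) powr (1 / p)) \<longlonglongrightarrow> 0" unfolding powr_0 .
      then have "(\<lambda>n. ?A * energy p M (u n) powr (1 / p) + B * energy p M (u n) powr (1 / p)) \<longlonglongrightarrow> ?A * 0 + B * 0"
        by (intro tendsto_intros)
      then show "(\<lambda>n. ?A * energy p M (u n) powr (1 / p) + B * energy p M (u n) powr (1 / p)) \<longlonglongrightarrow> 0" by simp
    qed
  next
    fix x y assume xy: "x \<in> K" "y \<in> K"
    have "0 \<le> T x (x - y) - T y (x - y)"
      unfolding T_diff[OF KL KL KL, OF xy diff_mem, OF xy]
    proof (rule Bochner_Integration.integral_nonneg)
      fix t
      show "0 \<le> (F (u0 t + x t) - F (u0 t + y t)) \<bullet> (x - y) t"
        using mono[of "u0 t + x t" "u0 t + y t"] by simp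
    qed
    then show "T y (x - y) - l (x - y) \<le> T x (x - y) - l (x - y)" by simp
  next
    fix z w assume zw: "z \<in> K" "w \<in> K"
    have "((\<lambda>t. T (z + t *\<^sub>R w) w) \<longlongrightarrow> T z w) (at_right 0)"
    proof (rule tendsto_at_right_sequentially[of 0 1])
      fix S :: "nat \<Rightarrow> real" assume S: "\<And>n. 0 < S n" "\<And>n. S n < 1" "S \<longlonglongrightarrow> 0"
      \<comment> \<open>A majorant of \<open>norm (u0 x + z x + t *\<^sub>R w x)\<close> for all
        \<open>t\<close> between 0 and 1, from which the dominating function is built.\<close>
      define h where "h x = norm (u0 x + z x) + norm (w x)" for x
      have zL: "u0 + z \<in> Lp p M" using u0 KL zw p by (intro Lp_add) auto
      have hL: "h \<in> Lp p M"
      proof -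
        have 1: "(\<lambda>x. norm (u0 x + z x)) \<in> Lp p M" using LpD[OF zL] by (auto simp: Lp_def plus_fun_def)
        have 2: "(\<lambda>x. norm (w x)) \<in> Lp p M" using LpD[OF KL[OF zw(2)]] by (auto simp: Lp_def)
        show ?thesis using Lp_add[OF _ 1 2] p by (simp add: h_def[abs_def] plus_fun_def)
      qed
      have C0: "C \<ge> 0" using C[of 0] p by (auto intro: order_trans[OF norm_ge_zero])
      have gL: "(\<lambda>x. C * (1 + \<bar>h x\<bar> powr (p - 1))) \<in> Lp r M"
        using nemytskii_Lp[OF M p1 _ _ hL, of "\<lambda>y. C * (1 + \<bar>y\<bar> powr (p - 1))" C] C0
        by (simp add: r_def abs_mult)
      note GI = holder(1)[OF r(1) p1 r(2) gL KL[OF zw(2)]]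
      show "(\<lambda>n. T (z + S n *\<^sub>R w) w) \<longlonglongrightarrow> T z w"
        unfolding T_def
      proof (rule integral_dominated_convergence[OF _ _ GI])
        show "(\<lambda>x. F (u0 x + z x) \<bullet> w x) \<in> borel_measurable M" using FI[OF KL KL, OF zw] by auto
        show "(\<lambda>x. F (u0 x + (z + S n *\<^sub>R w) x) \<bullet> w x) \<in> borel_measurable M" for n
          using FI[OF KL KL, OF add_mem[OF zw(1) scale_mem[OF zw(2), of "S n"]] zw(2)] by auto
        show "AE x in M. (\<lambda>n. F (u0 x + (z + S n *\<^sub>R w) x) \<bullet> w x) \<longlonglongrightarrow> F (u0 x + z x) \<bullet> w x"
        proof (rule AE_I2)
          fix x
          have "(\<lambda>n. u0 x + (z x + S n *\<^sub>R w x)) \<longlonglongrightarrow> u0 x + (z x + 0 *\<^sub>R w x)"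
            by (intro tendsto_intros S)
          then have "(\<lambda>n. F (u0 x + (z x + S n *\<^sub>R w x))) \<longlonglongrightarrow> F (u0 x + (z x + 0 *\<^sub>R w x))"
            by (intro continuous_on_tendsto_compose[OF F]) auto
          then show "(\<lambda>n. F (u0 x + (z + S n *\<^sub>R w) x) \<bullet> w x) \<longlonglongrightarrow> F (u0 x + z x) \<bullet> w x"
            by (auto intro!: tendsto_intros)
        qed
        show "AE x in M. norm (F (u0 x + (z + S n *\<^sub>R w) x) \<bullet> w x) \<le> norm (C * (1 + \<bar>h x\<bar> powr (p - 1))) * norm (w x)" for n
        proof (rule AE_I2)
          fix x
          let ?y = "u0 x + (z + S n *\<^sub>R w) x"
          have "norm ?y \<le> norm (u0 x + z x) + norm (S n *\<^sub>R w x)"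
            using norm_triangle_ineq[of "u0 x + z x" "S n *\<^sub>R w x"] by (simp add: add.assoc)
          also have "norm (S n *\<^sub>R w x) \<le> 1 * norm (w x)" unfolding norm_scaleR using S(1,2)[of n] by (intro mult_right_mono) auto
          finally have "norm ?y \<le> \<bar>h x\<bar>" by (simp add: h_def)
          then have "norm ?y powr (p - 1) \<le> \<bar>h x\<bar> powr (p - 1)" using p by (intro powr_mono2) auto
          then have "norm (F ?y) \<le> C * (1 + \<bar>h x\<bar> powr (p - 1))"
            using C[of ?y] C0 by (meson add_left_mono mult_left_mono order_trans)
          also have "\<dots> \<le> norm (C * (1 + \<bar>h x\<bar> powr (p - 1)))" by simp
          finally have "norm (F ?y) * norm (w x) \<le> norm (C * (1 + \<bar>h x\<bar> powr (p - 1))) * norm (w x)"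
            by (rule mult_right_mono) simp
          then show "norm (F ?y \<bullet> w x) \<le> norm (C * (1 + \<bar>h x\<bar> powr (p - 1))) * norm (w x)"
            using Cauchy_Schwarz_ineq2[of "F ?y" "w x"] by simp
        qed
      qed
    qed simp
    then show "((\<lambda>t. T (z + t *\<^sub>R w) w - l w) \<longlongrightarrow> T z w - l w) (at_right 0)"
      by (intro tendsto_intros)
  next
    fix z assume z: "z \<in> K" "T z z - l z \<le> 0"
    define e where "e = energy p M z"
    have e0: "e \<ge> 0" by (simp add: e_def energy_nonneg)
    have "c * e = (LINT x|M. c * norm (z x) powr p)" by (simp add: e_def energy_def)
    also have "\<dots> \<le> (LINT x|M. (F (u0 x + z x) - F (u0 x + (0::'a \<Rightarrow> 'b) x)) \<bullet> z x)"
      using LpD(2)[OF KL[OF z(1)]] FDI[OF KL[OF z(1)] Lp_0 KL[OF z(1)]] c(2) by (intro integral_mono) auto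
    also have "\<dots> = T z z - T 0 z"
      by (rule T_diff[OF KL[OF z(1)] Lp_0 KL[OF z(1)], symmetric])
    also have "\<dots> \<le> l z - T 0 z" using z by simp
    also have "\<dots> \<le> B * e powr (1 / p) + B0 * e powr (1 / p)"
      using FB[OF Lp_0 KL[OF z(1)]] B[OF z(1)] unfolding T_def B0_def e_def by linarith
    also have "\<dots> = c * ((B + B0) / c * e powr (1 / p))" using c(1) by (simp add: field_simps)
    also have "\<dots> \<le> c * (D * e powr (1 / p))" using c(1) by (intro mult_left_mono mult_right_mono) (auto simp: D_def)
    finally have le: "e \<le> D * e powr (1 / p)" using c(1) by simp
    have "e \<le> D powr r" by (rule le_powr_conjugate[OF p1 r(1) _ e0 _ le]) (use r(2) in \<open>auto simp: D_def\<close>)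
    then show "energy p M z < D powr r + 1" by (simp add: e_def)
  qed
  then show ?thesis unfolding T_def by auto
qed

subsection \<open>Riesz representation\<close>

text \<open>The power map \<open>F\<close> is the derivative of
  \<open>\<bar>y\<bar> powr p / p\<close>. Solving the equation with right side \<open>l\<close> on
  the whole space gives \<open>z\<close>, and the representative is the composition of
  \<open>F\<close> with \<open>z\<close>, which lies in the conjugate space by its growth.\<close>

lemma riesz_Lp:
  fixes l :: "('a \<Rightarrow> real) \<Rightarrow> real"
  assumes M: "finite_measure M" and p: "p > 2"
    and lin: "\<And>v w a b. v \<in> Lp p M \<Longrightarrow> w \<in> Lp p M \<Longrightarrow> l (a *\<^sub>R v + b *\<^sub>R w) = a * l v + b * l w"
    and B: "\<And>v. v \<in> Lp p M \<Longrightarrow> \<bar>l v\<bar> \<le> B * energy p M v powr (1 / p)"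
  shows "\<exists>g\<in>Lp (p / (p - 1)) M. \<forall>v\<in>Lp p M. (LINT x|M. g x * v x) = l v"
proof -
  define F :: "real \<Rightarrow> real" where "F y = y * \<bar>y\<bar> powr (p - 2)" for y
  have absF: "\<bar>F y\<bar> = \<bar>y\<bar> powr (p - 1)" for y
    using p powr_add[of "\<bar>y\<bar>" 1 "p - 2"] by (cases "y = 0") (auto simp: F_def abs_mult)
  have F_self: "F y * y = \<bar>y\<bar> * \<bar>y\<bar> powr (p - 1)" for y
  proof -
    have "F y * y = (y * y) * \<bar>y\<bar> powr (p - 2)" by (simp add: F_def)
    also have "y * y = \<bar>y\<bar> * \<bar>y\<bar>" by simp
    also have "\<bar>y\<bar> * \<bar>y\<bar> * \<bar>y\<bar> powr (p - 2) = \<bar>y\<bar> * \<bar>F y\<bar>" by (simp only: F_def abs_mult) simp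
    finally show ?thesis unfolding absF .
  qed
  have cont: "continuous_on UNIV F"
    unfolding F_def using p by (intro continuous_intros continuous_on_powr') auto
  have growth: "norm (F y) \<le> 1 * (1 + norm y powr (p - 1))" for y
    using absF[of y] by simp
  have mono: "0 \<le> (F y - F z) \<bullet> (y - z)" for y z
  proof -
    \<comment> \<open>Signs only help: the cross terms \<open>F y * z\<close> and
      \<open>F z * y\<close> are at most their absolute values, so monotonicity reduces to that of
      the power function on nonnegative numbers.\<close>
    have "0 \<le> (\<bar>y\<bar> powr (p - 1) - \<bar>z\<bar> powr (p - 1)) * (\<bar>y\<bar> - \<bar>z\<bar>)"
    proof (cases "\<bar>y\<bar> \<le> \<bar>z\<bar>")
      case True
      then show ?thesis using p powr_mono2[of "p - 1" "\<bar>y\<bar>" "\<bar>z\<bar>"] by (intro mult_nonpos_nonpos) auto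
    next
      case False
      then show ?thesis using p powr_mono2[of "p - 1" "\<bar>z\<bar>" "\<bar>y\<bar>"] by (intro mult_nonneg_nonneg) auto
    qed
    also have "\<dots> = F y * y + F z * z - \<bar>F y * z\<bar> - \<bar>F z * y\<bar>"
      unfolding F_self abs_mult absF by (simp add: algebra_simps)
    also have "\<dots> \<le> F y * y + F z * z - F y * z - F z * y"
      using abs_ge_self[of "F y * z"] abs_ge_self[of "F z * y"] by linarith
    also have "\<dots> = (F y - F z) \<bullet> (y - z)" by (simp add: algebra_simps)
    finally show ?thesis .
  qed
  have coer: "1 * norm z powr p \<le> (F ((0::'a \<Rightarrow> real) x + z) - F ((0::'a \<Rightarrow> real) x)) \<bullet> z" for x z
  proof -
    have "\<bar>z\<bar> powr p = \<bar>z\<bar> * \<bar>z\<bar> powr (p - 1)"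
      using powr_add[of "\<bar>z\<bar>" 1 "p - 1"] by (cases "z = 0") auto
    moreover have "F 0 = 0" by (simp add: F_def)
    ultimately show ?thesis using F_self[of z] by simp
  qed
  have "\<exists>z\<in>Lp p M. \<forall>v\<in>Lp p M. (LINT x|M. F ((0::'a \<Rightarrow> real) x + z x) \<bullet> v x) = l v"
    using p by (intro monotone_Lp_solve[OF M _ cont growth mono Lp_0 _ coer _ _ _ lin B] subspace_Lp) auto
  then obtain z where z: "z \<in> Lp p M" "\<forall>v\<in>Lp p M. (LINT x|M. F (z x) * v x) = l v" by auto
  have "(\<lambda>x. F (z x)) \<in> Lp (p / (p - 1)) M"
    using p by (intro nemytskii_Lp[OF M _ borel_measurable_continuous_onI[OF cont] growth z(1)]) auto
  then show ?thesis using z by (intro bexI[of _ "\<lambda>x. F (z x)"]) auto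
qed

section \<open>Embeddings on finite measure spaces and the dual representation\<close>

lemma Lp_bounded:
  assumes M: "finite_measure M" and f: "f \<in> borel_measurable M" "\<And>x. norm (f x) \<le> k" and "p \<ge> 0"
  shows "f \<in> Lp p M"
proof (rule Lp_dominated[OF _ f(1)])
  interpret finite_measure M by fact
  show "integrable M (\<lambda>_. k powr p)" by simp
  show "norm (f x) powr p \<le> k powr p" for x using f(2)[of x] \<open>p \<ge> 0\<close> by (intro powr_mono2) auto
qed

text \<open>Hoelder's inequality for \<open>norm (f x) powr r\<close> against the constant 1, with
  exponent \<open>p / r\<close>.\<close>

lemma Lp_embedding:
  fixes f :: "'a \<Rightarrow> 'b::euclidean_space"
  assumes M: "finite_measure M" and pr: "0 < r" "r < p" and f: "f \<in> Lp p M"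
  shows "f \<in> Lp r M"
    and "energy r M f powr (1 / r) \<le> measure M (space M) powr ((1 - r / p) / r) * energy p M f powr (1 / p)"
proof -
  define q where "q = p / r"
  have q: "q > 1" "q / (q - 1) > 1" "1 / q + 1 / (q / (q - 1)) = 1"
    using pr by (auto simp: q_def field_simps)
  have g: "(\<lambda>x. norm (f x) powr r) \<in> Lp q M"
    using LpD[OF f] pr by (auto simp: Lp_def powr_powr q_def)
  have one: "(\<lambda>x. 1::real) \<in> Lp (q / (q - 1)) M"
    using q(2) by (intro Lp_bounded[OF M, where k = 1]) auto
  note H = holder[OF q g one]
  show "f \<in> Lp r M" using H(1) LpD[OF f] by (auto simp: Lp_def)
  have e1: "energy (q / (q - 1)) M (\<lambda>x. 1::real) = measure M (space M)"
    by (simp add: energy_def)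
  have e2: "energy q M (\<lambda>x. norm (f x) powr r) = energy p M f"
    using pr by (simp add: energy_def powr_powr q_def)
  have "energy r M f \<le> energy p M f powr (1 / q) * measure M (space M) powr (1 / (q / (q - 1)))"
    using H(2) unfolding e1 e2 by (simp add: energy_def)
  then have "energy r M f powr (1 / r) \<le> (energy p M f powr (1 / q) * measure M (space M) powr (1 / (q / (q - 1)))) powr (1 / r)"
    using pr by (intro powr_mono2) (auto simp: energy_nonneg)
  also have "\<dots> = measure M (space M) powr ((1 - r / p) / r) * energy p M f powr (1 / p)"
    using pr q by (simp add: powr_mult powr_powr q_def field_simps energy_nonneg)
  finally show "energy r M f powr (1 / r) \<le> measure M (space M) powr ((1 - r / p) / r) * energy p M f powr (1 / p)" .
qed

text \<open>For \<open>r < 2\<close> the energy is not covered by Clarkson's inequality, so the representative is first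
  found by restricting the functional to the smaller space with exponent \<open>p\<close>, and its integrability is
  then improved by testing with truncated powers of itself.\<close>

lemma riesz_Lp_dual:
  fixes l :: "('a \<Rightarrow> real) \<Rightarrow> real"
  assumes M: "finite_measure M" and p: "p > 2" and r_def: "r = p / (p - 1)"
    and lin: "\<And>v w a b. v \<in> Lp r M \<Longrightarrow> w \<in> Lp r M \<Longrightarrow> l (a *\<^sub>R v + b *\<^sub>R w) = a * l v + b * l w"
    and B: "\<And>v. v \<in> Lp r M \<Longrightarrow> \<bar>l v\<bar> \<le> B * energy r M v powr (1 / r)"
  shows "\<exists>g\<in>Lp p M. \<forall>q\<in>Lp r M. (LINT x|M. g x * q x) = l q"
proof -
  interpret finite_measure M by fact
  have p1: "p > 1" using p by simp
  note r = conjugate_exponent[OF p1, folded r_def]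
  have "p / (p - 1) < p * 1" using p by (subst divide_less_eq) auto
  then have rp: "0 < r" "r < p" using r unfolding r_def by auto
  note emb = Lp_embedding[OF M rp]
  let ?C = "\<bar>B\<bar> * measure M (space M) powr ((1 - r / p) / r)"
  have B': "\<bar>l v\<bar> \<le> ?C * energy p M v powr (1 / p)" if "v \<in> Lp p M" for v
  proof -
    have "\<bar>l v\<bar> \<le> B * energy r M v powr (1 / r)" using B emb(1)[OF that] by blast
    also have "\<dots> \<le> \<bar>B\<bar> * energy r M v powr (1 / r)" by (intro mult_right_mono) auto
    also have "\<dots> \<le> \<bar>B\<bar> * (measure M (space M) powr ((1 - r / p) / r) * energy p M v powr (1 / p))"
      using emb(2)[OF that] by (intro mult_left_mono) auto
    finally show ?thesis by (simp add: mult_ac)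
  qed
  obtain g where g: "g \<in> Lp r M" and gl: "\<And>v. v \<in> Lp p M \<Longrightarrow> (LINT x|M. g x * v x) = l v"
    using riesz_Lp[OF M p lin B'] emb(1) unfolding r_def by blast
  note [measurable] = LpD(1)[OF g]
  have gp: "g \<in> Lp p M"
  proof -
    \<comment> \<open>The test function \<open>q k\<close> is built so that
      \<open>\<bar>q k\<bar> powr r = m k powr p\<close> while \<open>g * q k\<close> dominates
      \<open>m k powr p\<close>. Boundedness of \<open>l\<close> then gives
      \<open>e \<le> \<bar>B\<bar> * e powr (1 / r)\<close> for the energy \<open>e\<close> of
      \<open>m k\<close>, finite by truncation, and absorption bounds it independently of
      \<open>k\<close>.\<close>
    define m where "m k x = min \<bar>g x\<bar> (real k)" for k x
    define q where "q k x = sgn (g x) * m k x powr (p - 1)" for k x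
    have m0: "m k x \<ge> 0" for k x by (simp add: m_def)
    have [measurable]: "m k \<in> borel_measurable M" "q k \<in> borel_measurable M" for k
      unfolding m_def[abs_def] q_def[abs_def] by measurable
    have mL: "m k \<in> Lp p M" for k
      using p by (intro Lp_bounded[OF M, where k = "real k"]) (auto simp: m_def)
    have qb: "norm (q k x) \<le> real k powr (p - 1)" for k x
    proof -
      have "norm (q k x) \<le> 1 * m k x powr (p - 1)"
        unfolding q_def norm_mult by (intro mult_mono) (auto simp: sgn_if)
      also have "\<dots> \<le> real k powr (p - 1)" using p m0 by (auto intro!: powr_mono2 simp: m_def)
      finally show ?thesis .
    qed
    have qL: "q k \<in> Lp p M" for k
      by (intro Lp_bounded[OF M _ qb]) (use p in auto)
    have qm: "norm (q k x) powr r = norm (m k x) powr p" for k x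
      using r p by (cases "g x = 0") (auto simp: q_def m_def abs_mult powr_powr sgn_if)
    have eq: "energy r M (q k) = energy p M (m k)" for k
      unfolding energy_def qm by simp
    have le: "energy p M (m k) \<le> \<bar>B\<bar> powr p" for k
    proof (rule le_powr_conjugate[OF r(1) p1 r(2) energy_nonneg])
      have "energy p M (m k) \<le> (LINT x|M. g x * q k x)"
        unfolding energy_def
      proof (rule integral_mono[OF LpD(2)[OF mL]])
        show "integrable M (\<lambda>x. g x * q k x)"
          using holder_inner(1)[OF r(1) p1 r(2) g qL, of k] by simp
        fix x
        have "norm (m k x) powr p = m k x * m k x powr (p - 1)"
          using powr_add[of "m k x" 1 "p - 1"] m0[of k x] by (cases "m k x = 0") auto
        also have "\<dots> \<le> \<bar>g x\<bar> * m k x powr (p - 1)" by (intro mult_right_mono) (auto simp: m_def)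
        also have "\<dots> = g x * q k x" by (simp add: q_def abs_sgn mult_ac)
        finally show "norm (m k x) powr p \<le> g x * q k x" .
      qed
      also have "\<dots> = l (q k)" by (rule gl[OF qL])
      also have "\<dots> \<le> B * energy p M (m k) powr (1 / r)" using B[OF emb(1)[OF qL], of k] unfolding eq by simp
      also have "\<dots> \<le> \<bar>B\<bar> * energy p M (m k) powr (1 / r)" by (intro mult_right_mono) auto
      finally show "energy p M (m k) \<le> \<bar>B\<bar> * energy p M (m k) powr (1 / r)" .
    qed simp
    have "integrable M (\<lambda>x. norm (g x) powr p)"
    proof (rule fatou_bound(1)[OF LpD(2)[OF mL]])
      show "AE x in M. (\<lambda>k. norm (m k x) powr p) \<longlonglongrightarrow> norm (g x) powr p"
      proof (rule AE_I2)
        fix x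
        obtain N :: nat where "\<bar>g x\<bar> \<le> real N" using real_arch_simple by blast
        then have "\<forall>\<^sub>F k in sequentially. norm (m k x) powr p = norm (g x) powr p"
          by (intro eventually_sequentiallyI[of N]) (auto simp: m_def min_def)
        then show "(\<lambda>k. norm (m k x) powr p) \<longlonglongrightarrow> norm (g x) powr p" by (rule tendsto_eventually)
      qed
      show "\<forall>\<^sub>F k in sequentially. (LINT x|M. norm (m k x) powr p) \<le> \<bar>B\<bar> powr p"
        using le by (auto simp: energy_def)
    qed auto
    then show ?thesis by (simp add: Lp_def)
  qed
  have "(LINT x|M. g x * q x) = l q" if q: "q \<in> Lp r M" for q
  proof -
    note [measurable] = LpD(1)[OF q]
    \<comment> \<open>Truncations are bounded, so the identity is already known for them. They
      converge to \<open>q\<close> in L^r, and both sides are continuous there now that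
      \<open>g\<close> lies in L^p.\<close>
    define t where "t k x = max (- real k) (min (real k) (q x))" for k x
    have [measurable]: "t k \<in> borel_measurable M" for k unfolding t_def[abs_def] by measurable
    have tL: "t k \<in> Lp p M" for k
      using p by (intro Lp_bounded[OF M, where k = "real k"]) (auto simp: t_def)
    have qt: "q - t k \<in> Lp r M" for k using rp by (intro Lp_diff q emb(1)[OF tL]) auto
    have lim: "(\<lambda>k. energy r M (q - t k)) \<longlonglongrightarrow> 0"
    proof -
      have "(\<lambda>k. LINT x|M. norm ((q - t k) x) powr r) \<longlonglongrightarrow> (LINT x|M. 0)"
      proof (rule integral_dominated_convergence[OF _ _ LpD(2)[OF q]])
        show "AE x in M. (\<lambda>k. norm ((q - t k) x) powr r) \<longlonglongrightarrow> 0"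
        proof (rule AE_I2)
          fix x
          obtain N :: nat where "\<bar>q x\<bar> \<le> real N" using real_arch_simple by blast
          then have "\<forall>\<^sub>F k in sequentially. norm ((q - t k) x) powr r = 0"
            by (intro eventually_sequentiallyI[of N]) (auto simp: t_def min_def max_def)
          then show "(\<lambda>k. norm ((q - t k) x) powr r) \<longlonglongrightarrow> 0" by (rule tendsto_eventually)
        qed
        show "AE x in M. norm (norm ((q - t k) x) powr r) \<le> norm (q x) powr r" for k
        proof (rule AE_I2)
          fix x
          have "norm ((q - t k) x) \<le> norm (q x)" by (auto simp: t_def min_def max_def)
          then show "norm (norm ((q - t k) x) powr r) \<le> norm (q x) powr r"
            using rp by (auto intro!: powr_mono2)
        qed
      qed (simp_all add: fun_diff_def)
      then show ?thesis by (simp add: energy_def)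
    qed
    have lim': "(\<lambda>k. energy r M (q - t k) powr (1 / r)) \<longlonglongrightarrow> 0 powr (1 / r)"
      using lim rp by (intro tendsto_powr') (auto simp: energy_nonneg)
    have "\<bar>(LINT x|M. g x * q x) - l q\<bar> \<le> (energy p M g powr (1 / p) + B) * energy r M (q - t k) powr (1 / r)" for k
    proof -
      have I: "integrable M (\<lambda>x. g x * q x)" "integrable M (\<lambda>x. g x * t k x)"
        using holder_inner(1)[OF r(1) p1 r(2) q gp] holder_inner(1)[OF r(1) p1 r(2) emb(1)[OF tL] gp, of k]
        by (simp_all add: mult.commute)
      have "l (q - t k) = l q - l (t k)" using lin[OF q emb(1)[OF tL], of 1 "-1" k] by simp
      then have "(LINT x|M. g x * q x) - l q = (LINT x|M. (q - t k) x \<bullet> g x) - l (q - t k)"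
        using I gl[OF tL, of k] by (simp add: algebra_simps)
      then show ?thesis
        using holder_inner(2)[OF r(1) p1 r(2) qt gp, of k] B[OF qt, of k] by (simp add: algebra_simps)
    qed
    moreover have "(\<lambda>k. (energy p M g powr (1 / p) + B) * energy r M (q - t k) powr (1 / r)) \<longlonglongrightarrow> (energy p M g powr (1 / p) + B) * 0 powr (1 / r)"
      by (intro tendsto_mult_left lim')
    ultimately have "\<bar>(LINT x|M. g x * q x) - l q\<bar> \<le> (energy p M g powr (1 / p) + B) * 0 powr (1 / r)"
      by (intro LIMSEQ_le_const) auto
    then show ?thesis by simp
  qed
  then show ?thesis using gp by blast
qed

subsection \<open>A right inverse of the divergence\<close>

lemma test_fun_props:
  fixes \<phi> :: "real^'n \<Rightarrow> real"
  assumes "test_fun \<Omega> \<phi>"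
  shows "(\<phi> has_derivative frechet_derivative \<phi> (at x)) (at x)"
    and "continuous_on UNIV \<phi>"
    and "continuous_on UNIV (\<lambda>x. frechet_derivative \<phi> (at x) (axis i 1))"
    and "\<exists>B. \<forall>x. \<bar>\<phi> x\<bar> \<le> B"
    and "\<exists>B. \<forall>x. \<bar>frechet_derivative \<phi> (at x) (axis i 1)\<bar> \<le> B"
    and "x \<notin> \<Omega> \<Longrightarrow> \<phi> x = 0"
    and "x \<notin> \<Omega> \<Longrightarrow> frechet_derivative \<phi> (at x) (axis i 1) = 0"
proof -
  obtain K where K: "compact K" "K \<subseteq> \<Omega>" "\<And>x. x \<notin> K \<Longrightarrow> \<phi> x = 0" and sm: "smooth_fun \<phi>"
    using assms by (auto simp: test_fun_def)
  have diff: "\<phi> differentiable (at x)" and sm': "smooth_fun (\<lambda>x. frechet_derivative \<phi> (at x) (axis i 1))" for x i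
    using sm by (auto elim: smooth_fun.cases)
  have cont: "continuous_on UNIV f" if "smooth_fun f" for f :: "real^'n \<Rightarrow> real"
  proof -
    have "\<forall>x. f differentiable (at x)" using that by (auto elim: smooth_fun.cases)
    then show ?thesis
      by (simp add: continuous_on_eq_continuous_at differentiable_imp_continuous_within)
  qed
  show der: "(\<phi> has_derivative frechet_derivative \<phi> (at x)) (at x)" for x
    using diff[of x] frechet_derivative_works by blast
  show c0: "continuous_on UNIV \<phi>" by (rule cont[OF sm])
  show c1: "continuous_on UNIV (\<lambda>x. frechet_derivative \<phi> (at x) (axis i 1))" by (rule cont[OF sm'])
  have z1: "frechet_derivative \<phi> (at x) (axis i 1) = 0" if "x \<notin> K" for x
  proof -
    have "((\<lambda>_. 0) has_derivative frechet_derivative \<phi> (at x)) (at x)"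
      by (rule has_derivative_transform_within_open[OF der, of "- K"])
         (use K that in \<open>auto intro: open_Compl compact_imp_closed\<close>)
    then have "frechet_derivative \<phi> (at x) = (\<lambda>_. 0)"
      by (rule has_derivative_unique) simp
    then show ?thesis by simp
  qed
  have bdd: "\<exists>B. \<forall>x. \<bar>f x\<bar> \<le> B" if "continuous_on UNIV f" "\<And>x. x \<notin> K \<Longrightarrow> f x = 0" for f :: "real^'n \<Rightarrow> real"
  proof -
    have "bounded (f ` K)"
      using that(1) K(1) by (intro compact_imp_bounded compact_continuous_image) (auto intro: continuous_on_subset)
    then obtain B where "B > 0" "\<And>x. x \<in> K \<Longrightarrow> \<bar>f x\<bar> \<le> B" by (auto simp: bounded_pos)
    then show ?thesis using that(2) by (intro exI[of _ B]) (metis abs_zero less_imp_le)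
  qed
  show "\<exists>B. \<forall>x. \<bar>\<phi> x\<bar> \<le> B" by (rule bdd[OF c0 K(3)])
  show "\<exists>B. \<forall>x. \<bar>frechet_derivative \<phi> (at x) (axis i 1)\<bar> \<le> B" by (rule bdd[OF c1 z1])
  show "\<phi> x = 0" "frechet_derivative \<phi> (at x) (axis i 1) = 0" if "x \<notin> \<Omega>"
    using that K z1 by auto
qed

lemma lborel_translate:
  fixes h :: "'a::euclidean_space \<Rightarrow> real"
  assumes [measurable]: "h \<in> borel_measurable borel"
  shows "integrable lborel (\<lambda>x. h (x - c)) \<longleftrightarrow> integrable lborel h"
    and "(LINT x|lborel. h (x - c)) = (LINT x|lborel. h x)"
proof -
  have e: "distr lborel borel ((+) (- c)) = lborel" by (rule lborel_distr_plus)
  show "integrable lborel (\<lambda>x. h (x - c)) \<longleftrightarrow> integrable lborel h"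
    using integrable_distr_eq[of "(+) (- c)" lborel borel h] unfolding e by simp
  show "(LINT x|lborel. h (x - c)) = (LINT x|lborel. h x)"
    using integral_distr[of "(+) (- c)" lborel borel h] unfolding e by simp
qed

lemma borel_measurable_lebesgue_on:
  assumes "f \<in> borel_measurable borel"
  shows "f \<in> borel_measurable (lebesgue_on \<Omega>)"
  using assms by (intro measurable_restrict_space1 measurable_completion) simp

text \<open>Moves integrals over \<Omega> to \<open>lborel\<close>, the setting for Fubini's theorem
  and translation invariance.\<close>

lemma lebesgue_on_borel:
  fixes f :: "'a::euclidean_space \<Rightarrow> real"
  assumes \<Omega>: "\<Omega> \<in> sets borel" and f: "f \<in> borel_measurable borel"
  shows "integrable (lebesgue_on \<Omega>) f \<longleftrightarrow> integrable lborel (\<lambda>x. indicator \<Omega> x * f x)"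
    and "(LINT x|lebesgue_on \<Omega>. f x) = (LINT x|lborel. indicator \<Omega> x * f x)"
proof -
  have [measurable]: "\<Omega> \<in> sets borel" "f \<in> borel_measurable borel" by fact+
  have m: "(\<lambda>x. indicator \<Omega> x * f x) \<in> borel_measurable lborel" by simp
  have s: "\<Omega> \<inter> space lebesgue \<in> sets lebesgue" using \<Omega> by simp
  show "integrable (lebesgue_on \<Omega>) f \<longleftrightarrow> integrable lborel (\<lambda>x. indicator \<Omega> x * f x)"
    using integrable_restrict_space[OF s, of f] integrable_completion[OF m] by simp
  show "(LINT x|lebesgue_on \<Omega>. f x) = (LINT x|lborel. indicator \<Omega> x * f x)"
    using integral_restrict_space[OF s, of f] integral_completion[OF m] by simp
qed

text \<open>The field is \<open>v(x) = (\<integral>\<^sub>0\<^sup>L W(x - t e) dt) e\<close> with \<open>L\<close> exceeding the diameter of \<open>\<Omega>\<close>, so that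
  \<open>y + L e\<close> leaves \<open>\<Omega>\<close> for \<open>y\<close> in \<open>\<Omega>\<close>.\<close>

lemma div_right_inverse_borel:
  fixes \<Omega> :: "(real^'n) set" and W :: "real^'n \<Rightarrow> real"
  assumes \<Omega>: "\<Omega> \<in> sets borel" and b: "b > 0" "\<And>x. x \<in> \<Omega> \<Longrightarrow> norm x \<le> b" and s: "s > 1"
    and W[measurable]: "W \<in> borel_measurable borel" and W0: "\<And>x. x \<notin> \<Omega> \<Longrightarrow> W x = 0"
    and Ws: "integrable lborel (\<lambda>x. \<bar>W x\<bar> powr s)" and W1: "integrable lborel W"
  shows "\<exists>v. in_Lp s \<Omega> v \<and> weak_div \<Omega> v W \<and>
    energy s (lebesgue_on \<Omega>) v \<le> (2 * b + 1) powr s * (LINT x|lborel. \<bar>W x\<bar> powr s)"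
proof -
  \<comment> \<open>Any coordinate direction serves, and index types are inhabited.\<close>
  fix i :: 'n
  define e :: "real^'n" where "e = axis i 1"
  have ne: "norm e = 1" by (simp add: e_def norm_axis_1)
  define L where "L = 2 * b + 1"
  have L: "L > 0" using b by (simp add: L_def)
  have shift: "x + L *\<^sub>R e \<notin> \<Omega>" if "x \<in> \<Omega>" for x
  proof
    assume "x + L *\<^sub>R e \<in> \<Omega>"
    then have "norm (L *\<^sub>R e) \<le> b + b"
      using norm_triangle_ineq4[of "x + L *\<^sub>R e" x] b(2)[OF that] b(2)[of "x + L *\<^sub>R e"] by simp
    then show False using ne b by (simp add: L_def)
  qed
  define N where "N = restrict_space lborel {0..L}"
  interpret N: finite_measure N
    by (rule finite_measureI) (use L in \<open>simp add: N_def emeasure_restrict_space space_restrict_space\<close>)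
  interpret P: pair_sigma_finite N "lborel :: (real^'n) measure" ..
  have mN: "measure N (space N) = L"
    unfolding N_def using L by (simp add: measure_restrict_space space_restrict_space)
  have [measurable_cong]: "sets N = sets (restrict_space borel {0..L})" unfolding N_def
    by (rule sets_restrict_space_cong) simp
  have id[measurable]: "(\<lambda>t. t) \<in> borel_measurable N" unfolding N_def by (auto intro: measurable_restrict_space1)
  have prodm: "(\<lambda>(t, x). h (x - t *\<^sub>R e)) \<in> borel_measurable (N \<Otimes>\<^sub>M lborel)" if [measurable]: "h \<in> borel_measurable borel" for h :: "real^'n \<Rightarrow> real"
    by measurable
  have prodi: "integrable (N \<Otimes>\<^sub>M lborel) (\<lambda>(t, x). h (x - t *\<^sub>R e))"
    if [measurable]: "h \<in> borel_measurable borel" and h: "integrable lborel h" for h :: "real^'n \<Rightarrow> real"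
  proof (rule P.Fubini_integrable[OF prodm])
    have "(\<lambda>t. LINT x|lborel. norm (h (x - t *\<^sub>R e))) = (\<lambda>t. LINT x|lborel. norm (h x))"
      using lborel_translate(2)[of "\<lambda>x. norm (h x)"] by simp
    then show "integrable N (\<lambda>t. LINT x|lborel. norm (case (t, x) of (t, x) \<Rightarrow> h (x - t *\<^sub>R e)))" by simp
    show "AE t in N. integrable lborel (\<lambda>x. case (t, x) of (t, x) \<Rightarrow> h (x - t *\<^sub>R e))"
      using h lborel_translate(1)[of h] by simp
  qed simp
  define V where "V x = (LINT t|N. W (x - t *\<^sub>R e))" for x
  have Vm[measurable]: "V \<in> borel_measurable borel"
    unfolding V_def by measurable
  \<comment> \<open>Jensen's inequality, in the form of \<open>Lp_embedding\<close> with exponent 1,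
    bounds \<open>\<bar>V x\<bar> powr s\<close> by \<open>L powr (s - 1) * H x\<close> almost
    everywhere. By Fubini, \<open>H\<close> has \<open>L\<close> times the integral of
    \<open>\<bar>W x\<bar> powr s\<close>; together they give the factor
    \<open>L powr s\<close>.\<close>
  define H where "H x = (LINT t|N. \<bar>W (x - t *\<^sub>R e)\<bar> powr s)" for x
  have pi: "integrable (N \<Otimes>\<^sub>M lborel) (\<lambda>(t, x). \<bar>W (x - t *\<^sub>R e)\<bar> powr s)"
    by (rule prodi[OF _ Ws]) simp
  have H_int: "integrable lborel H" unfolding H_def by (rule P.integrable_snd[OF pi])
  have H_eq: "(LINT x|lborel. H x) = L * (LINT x|lborel. \<bar>W x\<bar> powr s)"
  proof -
    have "(LINT x|lborel. H x) = (LINT t|N. (LINT x|lborel. \<bar>W (x - t *\<^sub>R e)\<bar> powr s))"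
      unfolding H_def by (rule P.Fubini_integral[OF pi])
    also have "\<dots> = (LINT t|N. (LINT x|lborel. \<bar>W x\<bar> powr s))"
      using lborel_translate(2)[of "\<lambda>x. \<bar>W x\<bar> powr s"] by simp
    finally show ?thesis using mN by simp
  qed
  have VH: "AE x in lborel. \<bar>V x\<bar> powr s \<le> L powr (s - 1) * H x"
    using P.AE_integrable_snd[OF pi]
  proof eventually_elim
    fix x assume "integrable N (\<lambda>t. \<bar>W (x - t *\<^sub>R e)\<bar> powr s)"
    then have f: "(\<lambda>t. W (x - t *\<^sub>R e)) \<in> Lp s N" by (auto simp: Lp_def)
    have "\<bar>V x\<bar> \<le> (LINT t|N. \<bar>W (x - t *\<^sub>R e)\<bar>)"
      unfolding V_def using integral_norm_bound[of N "\<lambda>t. W (x - t *\<^sub>R e)"] by simp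
    also have "\<dots> \<le> L powr (1 - 1 / s) * H x powr (1 / s)"
      using Lp_embedding(2)[OF N.finite_measure_axioms _ s f] mN by (simp add: energy_def H_def)
    finally have "\<bar>V x\<bar> powr s \<le> (L powr (1 - 1 / s) * H x powr (1 / s)) powr s"
      using s by (intro powr_mono2) auto
    also have "\<dots> = L powr (s - 1) * H x"
      using s L by (simp add: powr_mult powr_powr algebra_simps H_def)
    finally show "\<bar>V x\<bar> powr s \<le> L powr (s - 1) * H x" .
  qed
  have Vs: "integrable lborel (\<lambda>x. \<bar>V x\<bar> powr s)"
  proof (rule Bochner_Integration.integrable_bound)
    show "integrable lborel (\<lambda>x. L powr (s - 1) * H x)" using H_int by simp
    show "AE x in lborel. norm (\<bar>V x\<bar> powr s) \<le> norm (L powr (s - 1) * H x)"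
      using VH by eventually_elim auto
  qed simp
  have Vle: "(LINT x|lborel. \<bar>V x\<bar> powr s) \<le> L powr s * (LINT x|lborel. \<bar>W x\<bar> powr s)"
  proof -
    have "(LINT x|lborel. \<bar>V x\<bar> powr s) \<le> (LINT x|lborel. L powr (s - 1) * H x)"
      using Vs H_int VH by (intro integral_mono_AE) auto
    also have "\<dots> = (L powr (s - 1) * L) * (LINT x|lborel. \<bar>W x\<bar> powr s)" using H_eq by simp
    also have "L powr (s - 1) * L = L powr s" using L powr_add[of L "s - 1" 1] by simp
    finally show ?thesis .
  qed
  define v where "v x = V x *\<^sub>R e" for x
  have vm[measurable]: "v \<in> borel_measurable borel" unfolding v_def by measurable
  have nv: "norm (v x) = \<bar>V x\<bar>" for x by (simp add: v_def ne)
  have Vind: "integrable lborel (\<lambda>x. indicator \<Omega> x * \<bar>V x\<bar> powr s)"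
    using integrable_mult_indicator[of \<Omega> lborel, OF _ Vs] \<Omega> by simp
  have "in_Lp s \<Omega> v"
    unfolding in_Lp_def nv using lebesgue_on_borel(1)[OF \<Omega>, of "\<lambda>x. \<bar>V x\<bar> powr s"] Vind
    by (auto intro: borel_measurable_lebesgue_on)
  moreover have "energy s (lebesgue_on \<Omega>) v \<le> (2 * b + 1) powr s * (LINT x|lborel. \<bar>W x\<bar> powr s)"
  proof -
    have "energy s (lebesgue_on \<Omega>) v = (LINT x|lborel. indicator \<Omega> x * \<bar>V x\<bar> powr s)"
      unfolding energy_def nv using lebesgue_on_borel(2)[OF \<Omega>, of "\<lambda>x. \<bar>V x\<bar> powr s"] by simp
    also have "\<dots> \<le> (LINT x|lborel. \<bar>V x\<bar> powr s)"
      using Vind Vs by (intro integral_mono) (auto simp: indicator_def)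
    finally show ?thesis using Vle by (simp add: L_def)
  qed
  moreover have "weak_div \<Omega> v W"
    unfolding weak_div_def
  proof (intro allI impI)
    fix \<phi> assume t: "test_fun \<Omega> \<phi>"
    note tp = test_fun_props[OF t]
    define \<psi> where "\<psi> x = frechet_derivative \<phi> (at x) e" for x
    have \<psi>c: "continuous_on UNIV \<psi>" unfolding \<psi>_def e_def by (rule tp(3))
    have [measurable]: "\<psi> \<in> borel_measurable borel" "\<phi> \<in> borel_measurable borel"
      using \<psi>c tp(2) by (auto intro: borel_measurable_continuous_onI)
    obtain B where B: "\<And>x. \<bar>\<psi> x\<bar> \<le> B" using tp(5) unfolding \<psi>_def e_def by blast
    have \<psi>0: "\<psi> x = 0" if "x \<notin> \<Omega>" for x using tp(7)[OF that] by (simp add: \<psi>_def e_def)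
    have vg: "v x \<bullet> grad \<phi> x = V x * \<psi> x" for x
      by (simp add: v_def grad_def \<psi>_def e_def inner_axis' inner_axis)
    \<comment> \<open>Fubini is applied twice, before and after the substitution
      \<open>x = y + t *\<^sub>R e\<close> that moves the translation from \<open>W\<close> to
      \<open>\<psi>\<close>; each application needs its own integrability.\<close>
    have prod\<psi>: "integrable (N \<Otimes>\<^sub>M lborel) (\<lambda>(t, x). W (x - t *\<^sub>R e) * \<psi> x)"
    proof (rule Bochner_Integration.integrable_bound)
      show "integrable (N \<Otimes>\<^sub>M lborel) (\<lambda>z. B * (case z of (t, x) \<Rightarrow> W (x - t *\<^sub>R e)))"
        using prodi[OF W W1] by simp
      show "AE z in N \<Otimes>\<^sub>M lborel. norm (case z of (t, x) \<Rightarrow> W (x - t *\<^sub>R e) * \<psi> x)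
          \<le> norm (B * (case z of (t, x) \<Rightarrow> W (x - t *\<^sub>R e)))"
      proof (rule AE_I2, clarify)
        fix t and x :: "real^'n"
        have "\<bar>W (x - t *\<^sub>R e)\<bar> * \<bar>\<psi> x\<bar> \<le> \<bar>W (x - t *\<^sub>R e)\<bar> * \<bar>B\<bar>" using B[of x] by (intro mult_left_mono) auto
        then show "norm (W (x - t *\<^sub>R e) * \<psi> x) \<le> norm (B * W (x - t *\<^sub>R e))" by (simp add: abs_mult mult.commute)
      qed
    qed measurable
    have prod\<psi>': "integrable (N \<Otimes>\<^sub>M lborel) (\<lambda>(t, y). W y * \<psi> (y + t *\<^sub>R e))"
    proof (rule Bochner_Integration.integrable_bound)
      show "integrable (N \<Otimes>\<^sub>M lborel) (\<lambda>(t, y). B * W y)"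
        using W1 by (intro P.Fubini_integrable) auto
      show "AE z in N \<Otimes>\<^sub>M lborel. norm (case z of (t, y) \<Rightarrow> W y * \<psi> (y + t *\<^sub>R e)) \<le> norm (case z of (t, y) \<Rightarrow> B * W y)"
      proof (rule AE_I2, clarify)
        fix t and y :: "real^'n"
        have "\<bar>W y\<bar> * \<bar>\<psi> (y + t *\<^sub>R e)\<bar> \<le> \<bar>W y\<bar> * \<bar>B\<bar>" using B[of "y + t *\<^sub>R e"] by (intro mult_left_mono) auto
        then show "norm (W y * \<psi> (y + t *\<^sub>R e)) \<le> norm (B * W y)" by (simp add: abs_mult mult.commute)
      qed
    qed measurable
    have ftc: "(LINT t|N. \<psi> (y + t *\<^sub>R e)) = \<phi> (y + L *\<^sub>R e) - \<phi> y" for y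
    proof -
      have "(LINT t|N. \<psi> (y + t *\<^sub>R e)) = (LINT t|lborel. indicator {0..L} t *\<^sub>R \<psi> (y + t *\<^sub>R e))"
        unfolding N_def by (rule integral_restrict_space) simp
      also have "\<dots> = \<phi> (y + L *\<^sub>R e) - \<phi> (y + 0 *\<^sub>R e)"
      proof (rule integral_FTC_atLeastAtMost)
        show "continuous_on {0..L} (\<lambda>t. \<psi> (y + t *\<^sub>R e))"
          by (intro continuous_on_compose2[OF \<psi>c] continuous_intros) auto
        fix t
        have "((\<lambda>t. \<phi> (y + t *\<^sub>R e)) has_derivative (\<lambda>h. frechet_derivative \<phi> (at (y + t *\<^sub>R e)) (h *\<^sub>R e))) (at t within {0..L})"
          by (rule has_derivative_compose[OF _ tp(1)]) (auto intro!: derivative_eq_intros)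
        then show "((\<lambda>t. \<phi> (y + t *\<^sub>R e)) has_vector_derivative \<psi> (y + t *\<^sub>R e)) (at t within {0..L})"
          unfolding has_vector_derivative_def \<psi>_def
          using linear_scale[OF has_derivative_linear[OF tp(1)]] by simp
      qed (use L in auto)
      finally show ?thesis by simp
    qed
    have "(LINT x|lebesgue_on \<Omega>. v x \<bullet> grad \<phi> x) = (LINT x|lborel. indicator \<Omega> x * (V x * \<psi> x))"
      unfolding vg by (rule lebesgue_on_borel(2)[OF \<Omega>]) simp
    also have "\<dots> = (LINT x|lborel. V x * \<psi> x)"
      using \<psi>0 by (intro Bochner_Integration.integral_cong) (auto simp: indicator_def)
    also have "\<dots> = (LINT x|lborel. (LINT t|N. W (x - t *\<^sub>R e) * \<psi> x))"
      unfolding V_def by simp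
    also have "\<dots> = (LINT t|N. (LINT x|lborel. W (x - t *\<^sub>R e) * \<psi> x))"
      by (rule P.Fubini_integral[OF prod\<psi>])
    also have "\<dots> = (LINT t|N. (LINT y|lborel. W y * \<psi> (y + t *\<^sub>R e)))"
    proof (rule Bochner_Integration.integral_cong[OF refl])
      fix t
      show "(LINT x|lborel. W (x - t *\<^sub>R e) * \<psi> x) = (LINT y|lborel. W y * \<psi> (y + t *\<^sub>R e))"
        using lborel_translate(2)[of "\<lambda>y. W y * \<psi> (y + t *\<^sub>R e)" "t *\<^sub>R e"] by simp
    qed
    also have "\<dots> = (LINT y|lborel. (LINT t|N. W y * \<psi> (y + t *\<^sub>R e)))"
      by (rule P.Fubini_integral[OF prod\<psi>', symmetric])
    also have "\<dots> = (LINT y|lborel. W y * (\<phi> (y + L *\<^sub>R e) - \<phi> y))"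
      using ftc by simp
    also have "\<dots> = (LINT y|lborel. - (indicator \<Omega> y * (W y * \<phi> y)))"
    proof (rule Bochner_Integration.integral_cong[OF refl])
      fix y
      show "W y * (\<phi> (y + L *\<^sub>R e) - \<phi> y) = - (indicator \<Omega> y * (W y * \<phi> y))"
        using W0[of y] tp(6)[OF shift, of y] by (cases "y \<in> \<Omega>") auto
    qed
    also have "\<dots> = - (LINT x|lebesgue_on \<Omega>. W x * \<phi> x)"
      using lebesgue_on_borel(2)[OF \<Omega>, of "\<lambda>x. W x * \<phi> x"] by simp
    finally show "(LINT x|lebesgue_on \<Omega>. v x \<bullet> grad \<phi> x) = - (LINT x|lebesgue_on \<Omega>. W x * \<phi> x)" .
  qed
  ultimately show ?thesis by blast
qed

section \<open>The weak divergence on bounded open sets\<close>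

lemma in_Lp_iff: "in_Lp p \<Omega> f \<longleftrightarrow> f \<in> Lp p (lebesgue_on \<Omega>)"
  by (simp add: in_Lp_def Lp_def)

lemma Lp_norm_eq: "Lp_norm p \<Omega> f = energy p (lebesgue_on \<Omega>) f powr (1 / p)"
  by (simp add: Lp_norm_def energy_def)

lemma finite_measure_lebesgue_on_bounded:
  "open \<Omega> \<Longrightarrow> bounded \<Omega> \<Longrightarrow> finite_measure (lebesgue_on \<Omega>)"
  by (intro finite_measure_lebesgue_on lmeasurable_open)

text \<open>The construction along lines composes the datum with maps on a product space, so a
  Lebesgue measurable datum is first replaced by a Borel representative vanishing off \<Omega>.
  Neither the energy nor the weak divergence notices the change.\<close>

lemma div_right_inverse:
  fixes \<Omega> :: "(real^'n) set"
  assumes \<Omega>: "open \<Omega>" "bounded \<Omega>" and s: "s > 1"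
  shows "\<exists>C\<ge>0. \<forall>w. in_Lp s \<Omega> w \<longrightarrow> (\<exists>v. in_Wdiv s \<Omega> v w \<and>
    energy s (lebesgue_on \<Omega>) v \<le> C * energy s (lebesgue_on \<Omega>) w)"
proof -
  let ?M = "lebesgue_on \<Omega>"
  have M: "finite_measure ?M" using \<Omega> by (rule finite_measure_lebesgue_on_bounded)
  have sb[measurable]: "\<Omega> \<in> sets borel" using \<Omega> by simp
  have sl: "\<Omega> \<inter> space lebesgue \<in> sets lebesgue" using sb by simp
  obtain b where b: "b > 0" "\<And>x. x \<in> \<Omega> \<Longrightarrow> norm x \<le> b" using \<Omega>(2) by (auto simp: bounded_pos)
  have "\<exists>v. in_Wdiv s \<Omega> v w \<and> energy s ?M v \<le> (2 * b + 1) powr s * energy s ?M w" if w: "in_Lp s \<Omega> w" for w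
  proof -
    have wm[measurable]: "w \<in> borel_measurable ?M" and wi: "integrable ?M (\<lambda>x. norm (w x) powr s)"
      using w by (auto simp: in_Lp_def)
    have "(\<lambda>x. if x \<in> \<Omega> then w x else 0) \<in> borel_measurable lebesgue"
      using wm sl by (intro borel_measurable_if_I) auto
    then obtain g where g[measurable]: "g \<in> borel_measurable lborel" and
      gw: "AE x in lborel. (if x \<in> \<Omega> then w x else 0) = g x"
      using completion_ex_borel_measurable_real by blast
    define W where "W x = indicator \<Omega> x * g x" for x
    have W[measurable]: "W \<in> borel_measurable borel" using g unfolding W_def by simp
    have Wm[measurable]: "W \<in> borel_measurable ?M" by (rule borel_measurable_lebesgue_on[OF W])
    have W0: "W x = 0" if "x \<notin> \<Omega>" for x using that by (simp add: W_def)
    have Ww: "AE x in ?M. W x = w x"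
      unfolding AE_restrict_space_iff[OF sl] using AE_completion[OF gw]
      by eventually_elim (auto simp: W_def)
    have eq: "AE x in ?M. norm (W x) powr s = norm (w x) powr s" using Ww by eventually_elim simp
    have en: "integrable ?M (\<lambda>x. norm (W x) powr s)"
      by (rule integrable_cong_AE_imp[OF wi]) (use eq in auto)
    have en': "energy s ?M W = energy s ?M w"
      unfolding energy_def by (rule integral_cong_AE[OF _ _ eq]) auto
    have WL: "W \<in> Lp s ?M" using en Wm by (simp add: Lp_def)
    have iW: "(\<lambda>x. indicator \<Omega> x * \<bar>W x\<bar> powr s) = (\<lambda>x. \<bar>W x\<bar> powr s)" "(\<lambda>x. indicator \<Omega> x * W x) = W"
      using W0 by (auto simp: indicator_def fun_eq_iff)
    have Ws: "integrable lborel (\<lambda>x. \<bar>W x\<bar> powr s)"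
      using en lebesgue_on_borel(1)[OF sb, of "\<lambda>x. \<bar>W x\<bar> powr s"] by (simp add: iW)
    have We: "energy s ?M W = (LINT x|lborel. \<bar>W x\<bar> powr s)"
      unfolding energy_def using lebesgue_on_borel(2)[OF sb, of "\<lambda>x. \<bar>W x\<bar> powr s"] by (simp add: iW)
    have "W \<in> Lp 1 ?M" using s by (intro Lp_embedding(1)[OF M _ _ WL]) auto
    then have "integrable ?M W" using integrable_abs_iff[OF Wm] by (simp add: Lp_def)
    then have W1: "integrable lborel W" using lebesgue_on_borel(1)[OF sb W] by (simp add: iW)
    obtain v where v: "in_Lp s \<Omega> v" "weak_div \<Omega> v W" "energy s ?M v \<le> (2 * b + 1) powr s * energy s ?M W"
      using div_right_inverse_borel[OF sb b s W W0 Ws W1] We by auto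
    have "weak_div \<Omega> v w"
      unfolding weak_div_def
    proof (intro allI impI)
      fix \<phi> assume t: "test_fun \<Omega> \<phi>"
      have [measurable]: "\<phi> \<in> borel_measurable ?M"
        using test_fun_props(2)[OF t] by (intro borel_measurable_lebesgue_on borel_measurable_continuous_onI)
      have "(LINT x|?M. W x * \<phi> x) = (LINT x|?M. w x * \<phi> x)"
        using Ww by (intro integral_cong_AE) auto
      then show "(LINT x|?M. v x \<bullet> grad \<phi> x) = - (LINT x|?M. w x * \<phi> x)"
        using v(2) t by (simp add: weak_div_def)
    qed
    then show ?thesis using v w en' by (auto simp: in_Wdiv_def)
  qed
  then show ?thesis by (intro exI[of _ "(2 * b + 1) powr s"]) auto
qed

lemma test_fun_Lp:
  fixes \<Omega> :: "(real^'n) set"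
  assumes M: "finite_measure (lebesgue_on \<Omega>)" and t: "test_fun \<Omega> \<phi>" and r: "r \<ge> 0"
  shows "\<phi> \<in> Lp r (lebesgue_on \<Omega>)" "grad \<phi> \<in> Lp r (lebesgue_on \<Omega>)"
proof -
  note tp = test_fun_props[OF t]
  obtain B where "\<And>x. \<bar>\<phi> x\<bar> \<le> B" using tp(4) by blast
  then show "\<phi> \<in> Lp r (lebesgue_on \<Omega>)"
    using tp(2) r by (intro Lp_bounded[OF M, where k = B] borel_measurable_lebesgue_on borel_measurable_continuous_onI) auto
  have "\<forall>i. \<exists>B. \<forall>x. \<bar>frechet_derivative \<phi> (at x) (axis i 1)\<bar> \<le> B" using tp(5) by blast
  then obtain Bi where Bi: "\<And>i x. \<bar>frechet_derivative \<phi> (at x) (axis i 1)\<bar> \<le> Bi i" by metis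
  have "norm (grad \<phi> x) \<le> (\<Sum>i\<in>UNIV. Bi i)" for x
    by (rule order_trans[OF norm_le_l1_cart]) (auto intro!: sum_mono Bi simp: grad_def)
  moreover have "continuous_on UNIV (grad \<phi>)"
    unfolding grad_def[abs_def] by (intro continuous_on_vec_lambda tp(3))
  ultimately show "grad \<phi> \<in> Lp r (lebesgue_on \<Omega>)"
    using r by (intro Lp_bounded[OF M] borel_measurable_lebesgue_on borel_measurable_continuous_onI) auto
qed

text \<open>The weak identities may be added because all the integrals exist: test functions and
  their gradients are bounded, hence in the conjugate space.\<close>

lemma in_Wdiv_combination:
  fixes \<Omega> :: "(real^'n) set"
  assumes M: "finite_measure (lebesgue_on \<Omega>)" and s: "s > 1"
    and v: "in_Wdiv s \<Omega> v1 w1" "in_Wdiv s \<Omega> v2 w2"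
  shows "in_Wdiv s \<Omega> (a *\<^sub>R v1 + b *\<^sub>R v2) (a *\<^sub>R w1 + b *\<^sub>R w2)"
proof -
  let ?M = "lebesgue_on \<Omega>"
  note r = conjugate_exponent[OF s]
  have r2: "1 / s + 1 / (s / (s - 1)) = 1" using r(2) by simp
  have L: "v1 \<in> Lp s ?M" "v2 \<in> Lp s ?M" "w1 \<in> Lp s ?M" "w2 \<in> Lp s ?M"
    using v by (auto simp: in_Wdiv_def in_Lp_iff)
  have "weak_div \<Omega> (a *\<^sub>R v1 + b *\<^sub>R v2) (a *\<^sub>R w1 + b *\<^sub>R w2)"
    unfolding weak_div_def
  proof (intro allI impI)
    fix \<phi> assume t: "test_fun \<Omega> \<phi>"
    have T: "\<phi> \<in> Lp (s / (s - 1)) ?M" "grad \<phi> \<in> Lp (s / (s - 1)) ?M" using test_fun_Lp[OF M t] r by auto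
    have I: "integrable ?M (\<lambda>x. v1 x \<bullet> grad \<phi> x)" "integrable ?M (\<lambda>x. v2 x \<bullet> grad \<phi> x)"
      "integrable ?M (\<lambda>x. w1 x * \<phi> x)" "integrable ?M (\<lambda>x. w2 x * \<phi> x)"
      using holder_inner(1)[OF s r(1) r2 L(1) T(2)] holder_inner(1)[OF s r(1) r2 L(2) T(2)]
        holder_inner(1)[OF s r(1) r2 L(3) T(1)] holder_inner(1)[OF s r(1) r2 L(4) T(1)] by auto
    have "(LINT x|?M. v1 x \<bullet> grad \<phi> x) = - (LINT x|?M. w1 x * \<phi> x)"
      "(LINT x|?M. v2 x \<bullet> grad \<phi> x) = - (LINT x|?M. w2 x * \<phi> x)"
      using v t by (auto simp: in_Wdiv_def weak_div_def)
    then show "(LINT x|?M. (a *\<^sub>R v1 + b *\<^sub>R v2) x \<bullet> grad \<phi> x) = - (LINT x|?M. (a *\<^sub>R w1 + b *\<^sub>R w2) x * \<phi> x)"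
      using I by (simp add: inner_add_left distrib_right mult.assoc)
  qed
  then show ?thesis
    using L s by (auto simp: in_Wdiv_def in_Lp_iff intro!: Lp_add Lp_scaleR)
qed

lemma in_Wdiv_0: "in_Wdiv s \<Omega> 0 0"
  by (auto simp: in_Wdiv_def in_Lp_iff weak_div_def intro: Lp_0)

lemma in_Wdiv_diff:
  fixes \<Omega> :: "(real^'n) set"
  assumes "finite_measure (lebesgue_on \<Omega>)" "s > 1" "in_Wdiv s \<Omega> v1 w1" "in_Wdiv s \<Omega> v2 w2"
  shows "in_Wdiv s \<Omega> (v1 - v2) (w1 - w2)"
  using in_Wdiv_combination[OF assms, of 1 "-1"] by simp

text \<open>For each test function the defining integral is continuous in L^s, by Hoelder's
  inequality against \<open>grad \<phi>\<close>.\<close>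

lemma div_free_closed:
  fixes \<Omega> :: "(real^'n) set"
  assumes M: "finite_measure (lebesgue_on \<Omega>)" and s: "s > 1"
    and u: "\<And>n::nat. in_Wdiv s \<Omega> (u n) 0" and v: "v \<in> Lp s (lebesgue_on \<Omega>)"
    and lim: "(\<lambda>n. energy s (lebesgue_on \<Omega>) (u n - v)) \<longlonglongrightarrow> 0"
  shows "in_Wdiv s \<Omega> v 0"
proof -
  let ?M = "lebesgue_on \<Omega>"
  note r = conjugate_exponent[OF s]
  have r2: "1 / s + 1 / (s / (s - 1)) = 1" using r(2) by simp
  have uL: "u n \<in> Lp s ?M" for n using u by (auto simp: in_Wdiv_def in_Lp_iff)
  have "(LINT x|?M. v x \<bullet> grad \<phi> x) = 0" if t: "test_fun \<Omega> \<phi>" for \<phi>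
  proof -
    have T: "grad \<phi> \<in> Lp (s / (s - 1)) ?M" using test_fun_Lp[OF M t] r by auto
    let ?A = "energy (s / (s - 1)) ?M (grad \<phi>) powr (1 / (s / (s - 1)))"
    have bound: "\<bar>LINT x|?M. v x \<bullet> grad \<phi> x\<bar> \<le> energy s ?M (u n - v) powr (1 / s) * ?A" for n
    proof -
      have uv: "u n - v \<in> Lp s ?M" using s by (intro Lp_diff uL v) auto
      have "(LINT x|?M. u n x \<bullet> grad \<phi> x) = 0" using u[of n] t by (simp add: in_Wdiv_def weak_div_def)
      then have "(LINT x|?M. (u n - v) x \<bullet> grad \<phi> x) = - (LINT x|?M. v x \<bullet> grad \<phi> x)"
        using holder_inner(1)[OF s r(1) r2 uL T, of n] holder_inner(1)[OF s r(1) r2 v T]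
        by (simp add: inner_diff_left)
      then show ?thesis using holder_inner(2)[OF s r(1) r2 uv T] by simp
    qed
    have "(\<lambda>n. energy s ?M (u n - v) powr (1 / s)) \<longlonglongrightarrow> 0 powr (1 / s)"
      using lim s by (intro tendsto_powr') (auto simp: energy_nonneg)
    then have "(\<lambda>n. energy s ?M (u n - v) powr (1 / s) * ?A) \<longlonglongrightarrow> 0 powr (1 / s) * ?A"
      by (rule tendsto_mult_right)
    then have "\<bar>LINT x|?M. v x \<bullet> grad \<phi> x\<bar> \<le> 0 powr (1 / s) * ?A"
      using bound by (intro LIMSEQ_le_const) auto
    then show ?thesis by simp
  qed
  then show ?thesis using v by (auto simp: in_Wdiv_def in_Lp_iff weak_div_def intro: Lp_0)
qed

subsection \<open>The mixed problem\<close>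

lemma flux_continuous:
  fixes F :: "real^'n \<Rightarrow> real^'n"
  assumes s: "s > 2"
    and F: "\<And>x y. norm (F x - F y) \<le> c1 * (1 + norm x powr (s - 2) + norm y powr (s - 2)) * norm (x - y)"
  shows "continuous_on UNIV F"
proof (clarsimp simp: continuous_on_eq_continuous_at continuous_at)
  fix y
  have "((\<lambda>x. F x - F y) \<longlongrightarrow> 0) (at y)"
  proof (rule Lim_null_comparison)
    show "\<forall>\<^sub>F x in at y. norm (F x - F y) \<le> c1 * (1 + norm x powr (s - 2) + norm y powr (s - 2)) * norm (x - y)"
      using F by auto
    have "((\<lambda>x. c1 * (1 + norm x powr (s - 2) + norm y powr (s - 2)) * norm (x - y))
        \<longlongrightarrow> c1 * (1 + norm y powr (s - 2) + norm y powr (s - 2)) * norm (y - y)) (at y)"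
      using s by (intro tendsto_intros tendsto_powr') auto
    then show "((\<lambda>x. c1 * (1 + norm x powr (s - 2) + norm y powr (s - 2)) * norm (x - y)) \<longlongrightarrow> 0) (at y)"
      by simp
  qed
  then show "(F \<longlongrightarrow> F y) (at y)" by (rule LIM_zero_cancel)
qed

text \<open>Comparison with the value at 0, where \<open>0 powr (s - 2) = 0\<close>. The linear term
  is absorbed through \<open>norm y \<le> 1 + norm y powr (s - 1)\<close>, whence the factor
  2.\<close>

lemma flux_growth:
  fixes F :: "real^'n \<Rightarrow> real^'n"
  assumes s: "s > 2" and c1: "c1 > 0" and F0: "F 0 = 0"
    and F: "\<And>x y. norm (F x - F y) \<le> c1 * (1 + norm x powr (s - 2) + norm y powr (s - 2)) * norm (x - y)"
  shows "norm (F y) \<le> 2 * c1 * (1 + norm y powr (s - 1))"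
proof -
  have "norm y * norm y powr (s - 2) = norm y powr (s - 1)"
    using powr_add[of "norm y" 1 "s - 2"] by (cases "y = 0") auto
  moreover have "norm y \<le> 1 + norm y powr (s - 1)"
  proof (cases "norm y \<le> 1")
    case False
    then have "norm y powr 1 \<le> norm y powr (s - 1)" using s by (intro powr_mono) auto
    then show ?thesis using False by simp
  qed (simp add: add_increasing2)
  ultimately have *: "(1 + norm y powr (s - 2)) * norm y \<le> 2 * (1 + norm y powr (s - 1))"
    using powr_ge_zero[of "norm y" "s - 1"] by (simp add: algebra_simps)
  have "norm (F y) \<le> c1 * ((1 + norm y powr (s - 2)) * norm y)" using F[of y 0] F0 s by (simp add: mult.assoc)
  also have "\<dots> \<le> c1 * (2 * (1 + norm y powr (s - 1)))" using * c1 by (intro mult_left_mono) auto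
  finally show ?thesis by (simp add: mult_ac)
qed

locale mixed_problem =
  fixes \<Omega> :: "(real^'n) set" and F :: "real^'n \<Rightarrow> real^'n" and s c1 c2 :: real
    and G :: "(real^'n \<Rightarrow> real^'n) \<Rightarrow> (real^'n \<Rightarrow> real) \<Rightarrow> real"
  assumes open_\<Omega>: "open \<Omega>" and bounded_\<Omega>: "bounded \<Omega>"
    and s: "s > 2" and c1: "c1 > 0" and c2: "c2 > 0" and F0: "F 0 = 0"
    and F_lip: "\<And>x y. norm (F x - F y) \<le> c1 * (1 + norm x powr (s - 2) + norm y powr (s - 2)) * norm (x - y)"
    and F_mono: "\<And>x y. c2 * norm (x - y) powr s \<le> (F x - F y) \<bullet> (x - y)"
    and G: "in_dual s \<Omega> G"
begin

abbreviation "M \<equiv> lebesgue_on \<Omega>"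

definition "r = s / (s - 1)"

lemma s1: "s > 1" using s by simp

lemmas r = conjugate_exponent[OF s1, folded r_def]

lemma finM: "finite_measure M"
  using open_\<Omega> bounded_\<Omega> by (rule finite_measure_lebesgue_on_bounded)

lemma in_WdivD: "in_Wdiv s \<Omega> v w \<Longrightarrow> v \<in> Lp s M" "in_Wdiv s \<Omega> v w \<Longrightarrow> w \<in> Lp s M"
  by (auto simp: in_Wdiv_def in_Lp_iff)

lemma F_Lp: "u \<in> Lp s M \<Longrightarrow> (\<lambda>x. F (u x)) \<in> Lp r M"
  unfolding r_def
  by (rule nemytskii_Lp[OF finM s1 borel_measurable_continuous_onI[OF flux_continuous[OF s F_lip]]
        flux_growth[OF s c1 F0 F_lip]])

lemmas F_integrable = holder_inner(1)[OF r(1) s1 r(2) F_Lp]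
lemmas F_bound = holder_inner(2)[OF r(1) s1 r(2) F_Lp]

lemma pairing_integrable:
  fixes q :: "real^'n \<Rightarrow> real"
  shows "w \<in> Lp s M \<Longrightarrow> q \<in> Lp r M \<Longrightarrow> integrable M (\<lambda>x. w x * q x)"
  using holder_inner(1)[OF r(1) s1 r(2), of q M w] by (simp add: mult.commute)

lemma G_linear:
  assumes "in_Wdiv s \<Omega> v1 w1" "in_Wdiv s \<Omega> v2 w2" "q1 \<in> Lp r M" "q2 \<in> Lp r M"
  shows "G (a *\<^sub>R v1 + b *\<^sub>R v2) (a *\<^sub>R q1 + b *\<^sub>R q2) = a * G v1 q1 + b * G v2 q2"
  using G assms unfolding in_dual_def Let_def r_def[symmetric] in_Lp_iff plus_fun_def scaleR_fun_def real_scaleR_def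
  by blast

lemma G_bounded:
  obtains C where "C \<ge> 0" "\<And>v w q. in_Wdiv s \<Omega> v w \<Longrightarrow> q \<in> Lp r M \<Longrightarrow>
    \<bar>G v q\<bar> \<le> C * ((energy s M v + energy s M w) powr (1 / s) + energy r M q powr (1 / r))"
proof -
  obtain C where C: "\<forall>v w q. in_Wdiv s \<Omega> v w \<and> in_Lp r \<Omega> q \<longrightarrow>
      \<bar>G v q\<bar> \<le> C * (Wdiv_norm s \<Omega> v w + Lp_norm r \<Omega> q)"
    using G unfolding in_dual_def Let_def r_def[symmetric] by blast
  show thesis
  proof (rule that[of "\<bar>C\<bar>"])
    fix v w and q :: "real^'n \<Rightarrow> real" assume "in_Wdiv s \<Omega> v w" "q \<in> Lp r M"
    then have "\<bar>G v q\<bar> \<le> C * (Wdiv_norm s \<Omega> v w + Lp_norm r \<Omega> q)" using C by (auto simp: in_Lp_iff)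
    also have "\<dots> \<le> \<bar>C\<bar> * (Wdiv_norm s \<Omega> v w + Lp_norm r \<Omega> q)"
      by (intro mult_right_mono) (auto simp: Wdiv_norm_def Lp_norm_def)
    finally show "\<bar>G v q\<bar> \<le> \<bar>C\<bar> * ((energy s M v + energy s M w) powr (1 / s) + energy r M q powr (1 / r))"
      by (simp add: Wdiv_norm_def Lp_norm_eq energy_def)
  qed simp
qed

lemma energy_0 [simp]: "energy p M 0 = 0"
  by (simp add: energy_def)

text \<open>Testing the difference of the equations with \<open>(u - u', p - p')\<close> cancels the
  two divergence terms, since they enter with opposite signs; strong monotonicity then identifies
  \<open>u\<close> and \<open>u'\<close>.\<close>

lemma uniqueness:
  assumes "solves s \<Omega> F G u du p" "solves s \<Omega> F G u' du' p'"
  shows "AE x in M. u' x = u x" "AE x in M. p' x = p x"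
proof -
  have W: "in_Wdiv s \<Omega> u du" "in_Wdiv s \<Omega> u' du'" and P: "p \<in> Lp r M" "p' \<in> Lp r M"
    using assms by (auto simp: solves_def Let_def in_Lp_iff r_def)
  have eq: "(LINT x|M. F (u x) \<bullet> v x) - (LINT x|M. dv x * p x) + (LINT x|M. du x * q x) =
      (LINT x|M. F (u' x) \<bullet> v x) - (LINT x|M. dv x * p' x) + (LINT x|M. du' x * q x)"
    if "in_Wdiv s \<Omega> v dv" "q \<in> Lp r M" for v dv q
    using assms that by (simp add: solves_def Let_def in_Lp_iff r_def)
  note L = in_WdivD(1)[OF W(1)] in_WdivD(2)[OF W(1)] in_WdivD(1)[OF W(2)] in_WdivD(2)[OF W(2)]
  have D: "in_Wdiv s \<Omega> (u - u') (du - du')" by (rule in_Wdiv_diff[OF finM s1 W])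
  have pL: "p - p' \<in> Lp r M" using r P by (intro Lp_diff) auto
  have uL: "u - u' \<in> Lp s M" and dL: "du - du' \<in> Lp s M" using in_WdivD[OF D] .
  note I = F_integrable[OF L(1) uL] F_integrable[OF L(3) uL] pairing_integrable[OF dL P(1)]
    pairing_integrable[OF dL P(2)] pairing_integrable[OF L(2) pL] pairing_integrable[OF L(4) pL]
  have "(LINT x|M. (F (u x) - F (u' x)) \<bullet> (u - u') x)
      = (LINT x|M. F (u x) \<bullet> (u - u') x) - (LINT x|M. F (u' x) \<bullet> (u - u') x)"
    unfolding inner_diff_left using I by (intro Bochner_Integration.integral_diff) auto
  also have "\<dots> = ((LINT x|M. (du - du') x * p x) - (LINT x|M. (du - du') x * p' x))
      - ((LINT x|M. du x * (p - p') x) - (LINT x|M. du' x * (p - p') x))"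
    using eq[OF D pL] by simp
  also have "(LINT x|M. (du - du') x * p x) - (LINT x|M. (du - du') x * p' x) = (LINT x|M. (du - du') x * (p - p') x)"
    using I by (subst Bochner_Integration.integral_diff[symmetric]) (auto simp: algebra_simps)
  also have "(LINT x|M. du x * (p - p') x) - (LINT x|M. du' x * (p - p') x) = (LINT x|M. (du - du') x * (p - p') x)"
    using I by (subst Bochner_Integration.integral_diff[symmetric]) (auto simp: algebra_simps)
  finally have "(LINT x|M. (F (u x) - F (u' x)) \<bullet> (u - u') x) = 0" by simp
  moreover have "c2 * energy s M (u - u') \<le> (LINT x|M. (F (u x) - F (u' x)) \<bullet> (u - u') x)"
  proof -
    have "c2 * energy s M (u - u') = (LINT x|M. c2 * norm ((u - u') x) powr s)" by (simp add: energy_def)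
    also have "\<dots> \<le> (LINT x|M. (F (u x) - F (u' x)) \<bullet> (u - u') x)"
      using LpD(2)[OF uL] I F_mono by (intro integral_mono) (auto simp: inner_diff_left)
    finally show ?thesis .
  qed
  ultimately have "energy s M (u - u') \<le> 0" using c2 by (simp add: mult_le_0_iff)
  then have "energy s M (u - u') = 0" using energy_nonneg[of s M "u - u'"] by linarith
  from energy_eq_0_AE[OF uL this] show uu: "AE x in M. u' x = u x" by eventually_elim simp
  \<comment> \<open>Once the flux terms agree, only the pressure terms remain, and every
    \<open>w\<close> in L^s occurs as a divergence.\<close>
  have pw: "(LINT x|M. w x * p x) = (LINT x|M. w x * p' x)" if w: "w \<in> Lp s M" for w
  proof -
    obtain v where v: "in_Wdiv s \<Omega> v w"
      using div_right_inverse[OF open_\<Omega> bounded_\<Omega> s1] w by (auto simp: in_Lp_iff)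
    note vL = in_WdivD(1)[OF v]
    have "(LINT x|M. F (u x) \<bullet> v x) = (LINT x|M. F (u' x) \<bullet> v x)"
    proof (rule integral_cong_AE)
      show "AE x in M. F (u x) \<bullet> v x = F (u' x) \<bullet> v x" using uu by eventually_elim simp
    qed (use F_integrable[OF L(1) vL] F_integrable[OF L(3) vL] in auto)
    then show ?thesis using eq[OF v Lp_0] by simp
  qed
  \<comment> \<open>The sign of \<open>p - p'\<close> is bounded, hence an admissible divergence in
    L^s, and it turns the pairing into the L^1 norm of \<open>p - p'\<close>.\<close>
  define w where "w x = sgn ((p - p') x)" for x
  have [measurable]: "p \<in> borel_measurable M" "p' \<in> borel_measurable M" using P LpD by auto
  have wL: "w \<in> Lp s M"
    using s1 by (intro Lp_bounded[OF finM, where k = 1]) (auto simp: w_def[abs_def] sgn_if)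
  have "(LINT x|M. \<bar>(p - p') x\<bar>) = (LINT x|M. w x * p x - w x * p' x)"
    by (intro Bochner_Integration.integral_cong refl) (simp add: w_def abs_sgn algebra_simps)
  also have "\<dots> = 0" using pw[OF wL] pairing_integrable[OF wL P(1)] pairing_integrable[OF wL P(2)] by simp
  finally have z: "(LINT x|M. \<bar>(p - p') x\<bar>) = 0" .
  have p1: "p - p' \<in> Lp 1 M"
    by (rule Lp_embedding(1)[OF finM _ r(1) pL]) simp
  have "energy 1 M (p - p') = 0" using z by (simp add: energy_def)
  from energy_eq_0_AE[OF p1 this]
  show "AE x in M. p' x = p x" by eventually_elim simp
qed

lemma existence: "\<exists>u du p. solves s \<Omega> F G u du p"
proof -
  obtain C where C0: "C \<ge> 0" and C: "\<And>v w q. in_Wdiv s \<Omega> v w \<Longrightarrow> q \<in> Lp r M \<Longrightarrow>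
    \<bar>G v q\<bar> \<le> C * ((energy s M v + energy s M w) powr (1 / s) + energy r M q powr (1 / r))"
    using G_bounded by blast
  obtain R where R0: "R \<ge> 0" and R: "\<And>w. w \<in> Lp s M \<Longrightarrow> \<exists>v. in_Wdiv s \<Omega> v w \<and> energy s M v \<le> R * energy s M w"
    using div_right_inverse[OF open_\<Omega> bounded_\<Omega> s1] by (auto simp: in_Lp_iff)
  have "\<exists>g\<in>Lp s M. \<forall>q\<in>Lp r M. (LINT x|M. g x * q x) = G 0 q"
  proof (rule riesz_Lp_dual[OF finM s r_def])
    show "G 0 (a *\<^sub>R v + b *\<^sub>R w) = a * G 0 v + b * G 0 w" if "v \<in> Lp r M" "w \<in> Lp r M" for v w a b
      using G_linear[OF in_Wdiv_0 in_Wdiv_0 that, of a b] by simp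
    show "\<bar>G 0 q\<bar> \<le> C * energy r M q powr (1 / r)" if "q \<in> Lp r M" for q
      using C[OF in_Wdiv_0 that] by simp
  qed
  then obtain g where g: "g \<in> Lp s M" and gG: "\<And>q. q \<in> Lp r M \<Longrightarrow> (LINT x|M. g x * q x) = G 0 q" by blast
  obtain u0 where u0: "in_Wdiv s \<Omega> u0 g" using R[OF g] by blast
  define K where "K = {z. in_Wdiv s \<Omega> z 0}"
  have comb: "in_Wdiv s \<Omega> (a *\<^sub>R v + b *\<^sub>R w) 0" if "in_Wdiv s \<Omega> v 0" "in_Wdiv s \<Omega> w 0" for a b v w
    using in_Wdiv_combination[OF finM s1 that, of a b] by simp
  have subK: "subspace K"
    unfolding subspace_def K_def
  proof (intro conjI ballI allI)
    show "0 \<in> {z. in_Wdiv s \<Omega> z 0}" using in_Wdiv_0 by simp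
    fix v assume v: "v \<in> {z. in_Wdiv s \<Omega> z 0}"
    show "a *\<^sub>R v \<in> {z. in_Wdiv s \<Omega> z 0}" for a using comb[of v v a 0] v by simp
    show "v + w \<in> {z. in_Wdiv s \<Omega> z 0}" if "w \<in> {z. in_Wdiv s \<Omega> z 0}" for w
      using comb[of v w 1 1] v that by simp
  qed
  have G0lin: "G (a *\<^sub>R v + b *\<^sub>R w) 0 = a * G v 0 + b * G w 0" if "in_Wdiv s \<Omega> v dv" "in_Wdiv s \<Omega> w dw" for v w dv dw a b
    using G_linear[OF that Lp_0 Lp_0, of a b] by simp
  have "\<exists>z\<in>K. \<forall>v\<in>K. (LINT x|M. F (u0 x + z x) \<bullet> v x) = G v 0"
  proof (rule monotone_Lp_solve[OF finM _ flux_continuous[OF s F_lip] flux_growth[OF s c1 F0 F_lip] _ in_WdivD(1)[OF u0] c2 _ subK])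
    show "s \<ge> 2" using s by simp
    show "0 \<le> (F y - F z) \<bullet> (y - z)" for y z
      by (rule order_trans[OF _ F_mono]) (use c2 in simp)
    show "c2 * norm z powr s \<le> (F (u0 x + z) - F (u0 x)) \<bullet> z" for x z
      using F_mono[where x = "u0 x + z" and y = "u0 x"] by simp
    show "K \<subseteq> Lp s M" using in_WdivD(1) by (auto simp: K_def)
    show "v \<in> K" if "\<And>n::nat. u n \<in> K" "v \<in> Lp s M" "(\<lambda>n. energy s M (u n - v)) \<longlonglongrightarrow> 0" for u v
      using div_free_closed[OF finM s1 _ that(2,3)] that(1) by (auto simp: K_def)
    show "G (a *\<^sub>R v + b *\<^sub>R w) 0 = a * G v 0 + b * G w 0" if "v \<in> K" "w \<in> K" for v w a b
      using that G0lin by (auto simp: K_def)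
    show "\<bar>G v 0\<bar> \<le> C * energy s M v powr (1 / s)" if "v \<in> K" for v
      using C[of v 0, OF _ Lp_0] that by (simp add: K_def)
  qed
  then obtain z where z: "in_Wdiv s \<Omega> z 0"
    and zG: "\<And>v. in_Wdiv s \<Omega> v 0 \<Longrightarrow> (LINT x|M. F (u0 x + z x) \<bullet> v x) = G v 0"
    by (auto simp: K_def)
  define u where "u = u0 + z"
  have u: "in_Wdiv s \<Omega> u g"
    using in_Wdiv_combination[OF finM s1 u0 z, of 1 1] by (simp add: u_def)
  note uL = in_WdivD(1)[OF u]
  \<comment> \<open>The residual that the pressure must balance. It vanishes on divergence-free
    fields by the choice of \<open>z\<close>, hence depends on a field only through its
    divergence.\<close>
  define \<Phi> where "\<Phi> v = (LINT x|M. F (u x) \<bullet> v x) - G v 0" for v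
  have \<Phi>lin: "\<Phi> (a *\<^sub>R v + b *\<^sub>R w) = a * \<Phi> v + b * \<Phi> w" if "in_Wdiv s \<Omega> v dv" "in_Wdiv s \<Omega> w dw" for v w dv dw a b
    unfolding \<Phi>_def G0lin[OF that]
    using F_integrable[OF uL in_WdivD(1)[OF that(1)]] F_integrable[OF uL in_WdivD(1)[OF that(2)]]
    by (simp add: inner_add_right algebra_simps)
  have \<Phi>0: "\<Phi> v = 0" if "in_Wdiv s \<Omega> v 0" for v
    using zG[OF that] by (simp add: \<Phi>_def u_def)
  have \<Phi>wd: "\<Phi> v = \<Phi> v'" if v: "in_Wdiv s \<Omega> v w" "in_Wdiv s \<Omega> v' w" for v v' w
    using \<Phi>lin[OF v, of 1 "-1"] \<Phi>0[of "v - v'"] in_Wdiv_diff[OF finM s1 v] by simp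
  \<comment> \<open>A mere choice of lifts, with no linearity claimed. Composition with
    \<open>\<Phi>\<close> is nevertheless linear, because \<open>\<Phi>\<close> does not distinguish
    lifts of the same divergence.\<close>
  obtain \<rho> where \<rho>: "\<And>w. w \<in> Lp s M \<Longrightarrow> in_Wdiv s \<Omega> (\<rho> w) w" "\<And>w. w \<in> Lp s M \<Longrightarrow> energy s M (\<rho> w) \<le> R * energy s M w"
    using R by metis
  have "\<exists>p\<in>Lp (s / (s - 1)) M. \<forall>w\<in>Lp s M. (LINT x|M. p x * w x) = \<Phi> (\<rho> w)"
  proof (rule riesz_Lp[OF finM s])
    fix v w :: "real^'n \<Rightarrow> real" and a b assume vw: "v \<in> Lp s M" "w \<in> Lp s M"
    have *: "in_Wdiv s \<Omega> (a *\<^sub>R \<rho> v + b *\<^sub>R \<rho> w) (a *\<^sub>R v + b *\<^sub>R w)"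
      by (rule in_Wdiv_combination[OF finM s1 \<rho>(1)[OF vw(1)] \<rho>(1)[OF vw(2)]])
    have "\<Phi> (\<rho> (a *\<^sub>R v + b *\<^sub>R w)) = \<Phi> (a *\<^sub>R \<rho> v + b *\<^sub>R \<rho> w)"
      by (rule \<Phi>wd[OF \<rho>(1)[OF in_WdivD(2)[OF *]] *])
    also have "\<dots> = a * \<Phi> (\<rho> v) + b * \<Phi> (\<rho> w)" by (rule \<Phi>lin[OF \<rho>(1)[OF vw(1)] \<rho>(1)[OF vw(2)]])
    finally show "\<Phi> (\<rho> (a *\<^sub>R v + b *\<^sub>R w)) = a * \<Phi> (\<rho> v) + b * \<Phi> (\<rho> w)" .
  next
    fix w :: "real^'n \<Rightarrow> real" assume w: "w \<in> Lp s M"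
    let ?A = "energy r M (\<lambda>x. F (u x)) powr (1 / r)" and ?e = "energy s M w"
    note \<rho>L = in_WdivD(1)[OF \<rho>(1)[OF w]]
    have "energy s M (\<rho> w) powr (1 / s) \<le> (R * ?e) powr (1 / s)"
      using \<rho>(2)[OF w] s1 by (intro powr_mono2) (auto simp: energy_nonneg)
    also have "\<dots> = R powr (1 / s) * ?e powr (1 / s)" by (simp add: powr_mult)
    finally have 1: "energy s M (\<rho> w) powr (1 / s) \<le> R powr (1 / s) * ?e powr (1 / s)" .
    \<comment> \<open>The V-norm of the lift also counts its divergence \<open>w\<close>, which
      accounts for \<open>R + 1\<close> in place of \<open>R\<close>.\<close>
    have "(energy s M (\<rho> w) + ?e) powr (1 / s) \<le> ((R + 1) * ?e) powr (1 / s)"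
      using \<rho>(2)[OF w] s1 by (intro powr_mono2) (auto simp: energy_nonneg distrib_right)
    also have "\<dots> = (R + 1) powr (1 / s) * ?e powr (1 / s)" by (simp add: powr_mult)
    finally have 2: "(energy s M (\<rho> w) + ?e) powr (1 / s) \<le> (R + 1) powr (1 / s) * ?e powr (1 / s)" .
    have "\<bar>\<Phi> (\<rho> w)\<bar> \<le> \<bar>LINT x|M. F (u x) \<bullet> \<rho> w x\<bar> + \<bar>G (\<rho> w) 0\<bar>"
      unfolding \<Phi>_def by simp
    also have "\<dots> \<le> ?A * energy s M (\<rho> w) powr (1 / s) + C * (energy s M (\<rho> w) + ?e) powr (1 / s)"
      using F_bound[OF uL \<rho>L] C[OF \<rho>(1)[OF w] Lp_0] by (intro add_mono) auto
    also have "\<dots> \<le> ?A * (R powr (1 / s) * ?e powr (1 / s)) + C * ((R + 1) powr (1 / s) * ?e powr (1 / s))"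
      using 1 2 C0 by (intro add_mono mult_left_mono) auto
    also have "\<dots> = (?A * R powr (1 / s) + C * (R + 1) powr (1 / s)) * ?e powr (1 / s)"
      by (simp add: algebra_simps)
    finally show "\<bar>\<Phi> (\<rho> w)\<bar> \<le> (?A * R powr (1 / s) + C * (R + 1) powr (1 / s)) * ?e powr (1 / s)" .
  qed
  then obtain p where p: "p \<in> Lp r M" and pw: "\<And>w. w \<in> Lp s M \<Longrightarrow> (LINT x|M. p x * w x) = \<Phi> (\<rho> w)"
    by (auto simp: r_def)
  have "solves s \<Omega> F G u g p"
    unfolding solves_def Let_def r_def[symmetric] in_Lp_iff
  proof (intro conjI allI impI u p)
    fix v dv and q :: "real^'n \<Rightarrow> real" assume "in_Wdiv s \<Omega> v dv \<and> q \<in> Lp r M"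
    then have v: "in_Wdiv s \<Omega> v dv" and q: "q \<in> Lp r M" by auto
    note dvL = in_WdivD(2)[OF v]
    have "(LINT x|M. dv x * p x) = \<Phi> v"
      using pw[OF dvL] \<Phi>wd[OF \<rho>(1)[OF dvL] v] by (simp add: mult.commute)
    moreover have "G v q = G v 0 + G 0 q"
      using G_linear[OF v in_Wdiv_0 Lp_0 q, of 1 1] by simp
    ultimately show "(LINT x|M. F (u x) \<bullet> v x) - (LINT x|M. dv x * p x) + (LINT x|M. g x * q x) = G v q"
      using gG[OF q] by (simp add: \<Phi>_def)
  qed
  then show ?thesis by blast
qed

end

theorem mainTheorem16:
  fixes \<Omega> :: "(real^'n) set" and F :: "real^'n \<Rightarrow> real^'n" and s c1 c2 :: real
    and G :: "(real^'n \<Rightarrow> real^'n) \<Rightarrow> (real^'n \<Rightarrow> real) \<Rightarrow> real"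
  assumes "CARD('n) \<ge> 2"
    and "open \<Omega>" and "bounded \<Omega>" and "C1_boundary \<Omega>"
    and "s > 2" and "c1 > 0" and "c2 > 0"
    and "F 0 = 0"
    and "\<And>x y. norm (F x - F y) \<le> c1 * (1 + norm x powr (s - 2) + norm y powr (s - 2)) * norm (x - y)"
    and "\<And>x y. (F x - F y) \<bullet> (x - y) \<ge> c2 * norm (x - y) powr s"
    and "in_dual s \<Omega> G"
  shows "\<exists>u du p. solves s \<Omega> F G u du p \<and>
           (\<forall>u' du' p'. solves s \<Omega> F G u' du' p' \<longrightarrow>
              (AE x in lebesgue_on \<Omega>. u' x = u x) \<and> (AE x in lebesgue_on \<Omega>. p' x = p x))"
proof -
  interpret mixed_problem \<Omega> F s c1 c2 G
    using assms by unfold_locales auto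
  show ?thesis using existence uniqueness by blast
qed

end
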